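(* Let $a>0$ and $x\in\mathbb{R}$. (a) If $\mathbb{P}\{\xi<0,\ \eta\le x\}=0$, then $\mathbb{E}\exp(a\tau(x))<\infty$ if and only if $e^{a}\,\mathbb{P}\{\xi=0,\ \eta\le x\}<1$. (b) If $\mathbb{P}\{\xi<0,\ \eta\le x\}>0$, then the following assertions are equivalent: (1) $\mathbb{E}\exp(a\tau(x))<\infty$; (2) $\mathbb{E}\exp(a\tau(y))<\infty$ for all $y\in\mathbb{R}$; (3) $\mathbb{E}\exp(a\tau^* )<\infty$; (4) $R:=-\log\inf_{t\ge0}\mathbb{E}e^{-t\xi}\ge a$.
   Context: Let $(\xi,\eta),(\xi_1,\eta_1),(\xi_2,\eta_2),\ldots$ be i.i.d. $\mathbb{R}^2$-valued random vectors; no condition is imposed on the dependence between $\xi$ and $\eta$. Put $S_0:=0$, $S_n:=\xi_1+\cdots+\xi_n$ for $n\in\mathbb{N}=\{1,2,\ldots\}$, and $T_n:=S_{n-1}+\eta_n$ for $n\in\mathbb{N}$. Standing assumption: $\mathbb{P}\{\xi=0\}<1$ and $\mathbb{P}\{\eta=0\}<1$. For $x\in\mathbb{R}$, $\tau(x):=\inf\{n\in\mathbb{N}:T_n>x\}$, and $\tau^*:=\inf\{n\in\mathbb{N}:S_n>0\}$, with $\inf\emptyset:=\infty$. Expectations may take the value $+\infty$, with $\exp(a\cdot\infty)=\infty$. *)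

theory Defs
  imports "HOL-Probability.Probability"
begin

text \<open>
  The i.i.d. family \<open>(\<xi>, \<eta>), (\<xi>\<^sub>1, \<eta>\<^sub>1), (\<xi>\<^sub>2, \<eta>\<^sub>2), \<dots>\<close> is indexed by the natural numbers.
  Index 0 is the generic pair \<open>(\<xi>, \<eta>)\<close>; the walks use only the indices \<open>k \<ge> 1\<close>.
  The dependence between \<open>\<xi> n\<close> and \<open>\<eta> n\<close> is arbitrary: independence is required of the pairs.
\<close>

locale perturbed_random_walk = prob_space M
  for M :: "'a measure" and \<xi> \<eta> :: "nat \<Rightarrow> 'a \<Rightarrow> real" +
  assumes indep_pairs:
      "indep_vars (\<lambda>_. borel :: (real \<times> real) measure) (\<lambda>n \<omega>. (\<xi> n \<omega>, \<eta> n \<omega>)) UNIV"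
    and identically_distributed:
      "\<And>n. distr M (borel :: (real \<times> real) measure) (\<lambda>\<omega>. (\<xi> n \<omega>, \<eta> n \<omega>)) =
           distr M borel (\<lambda>\<omega>. (\<xi> 0 \<omega>, \<eta> 0 \<omega>))"
    and xi_nondegenerate: "\<P>(\<omega> in M. \<xi> 0 \<omega> = 0) < 1"
    and eta_nondegenerate: "\<P>(\<omega> in M. \<eta> 0 \<omega> = 0) < 1"

definition walk :: "(nat \<Rightarrow> 'a \<Rightarrow> real) \<Rightarrow> nat \<Rightarrow> 'a \<Rightarrow> real" where
  "walk \<xi> n \<omega> = (\<Sum>k=1..n. \<xi> k \<omega>)"

text \<open>Meaningful for \<open>n \<ge> 1\<close> only.\<close>

definition perturbed_walk ::
  "(nat \<Rightarrow> 'a \<Rightarrow> real) \<Rightarrow> (nat \<Rightarrow> 'a \<Rightarrow> real) \<Rightarrow> nat \<Rightarrow> 'a \<Rightarrow> real" where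
  "perturbed_walk \<xi> \<eta> n \<omega> = walk \<xi> (n - 1) \<omega> + \<eta> n \<omega>"

text \<open>In \<^typ>\<open>enat\<close> the infimum of the empty set is \<open>\<infinity>\<close>.\<close>

definition first_passage ::
  "(nat \<Rightarrow> 'a \<Rightarrow> real) \<Rightarrow> (nat \<Rightarrow> 'a \<Rightarrow> real) \<Rightarrow> real \<Rightarrow> 'a \<Rightarrow> enat" where
  "first_passage \<xi> \<eta> x \<omega> = (INF n\<in>{n. 1 \<le> n \<and> perturbed_walk \<xi> \<eta> n \<omega> > x}. enat n)"

definition ladder_epoch :: "(nat \<Rightarrow> 'a \<Rightarrow> real) \<Rightarrow> 'a \<Rightarrow> enat" where
  "ladder_epoch \<xi> \<omega> = (INF n\<in>{n. 1 \<le> n \<and> walk \<xi> n \<omega> > 0}. enat n)"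

text \<open>\<open>exp (a * n)\<close> for \<open>a > 0\<close> and an extended natural number \<open>n\<close>.\<close>

definition exp_enat :: "real \<Rightarrow> enat \<Rightarrow> ennreal" where
  "exp_enat a n = (case n of enat k \<Rightarrow> ennreal (exp (a * real k)) | \<infinity> \<Rightarrow> \<infinity>)"

definition exp_moment :: "'a measure \<Rightarrow> real \<Rightarrow> ('a \<Rightarrow> enat) \<Rightarrow> ennreal" where
  "exp_moment M a N = (\<integral>\<^sup>+\<omega>. exp_enat a (N \<omega>) \<partial>M)"

definition neg_ln :: "ennreal \<Rightarrow> ereal" where
  "neg_ln u = (if u = 0 then \<infinity> else if u = \<infinity> then -\<infinity> else ereal (- ln (enn2real u)))"

text \<open>\<open>R = - log inf {E exp (-t X) | t \<ge> 0}\<close>, where the Laplace transform may be infinite.\<close>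

definition exp_rate :: "'a measure \<Rightarrow> ('a \<Rightarrow> real) \<Rightarrow> ereal" where
  "exp_rate M X = neg_ln (INF t\<in>{0..}. \<integral>\<^sup>+\<omega>. ennreal (exp (- t * X \<omega>)) \<partial>M)"

end

theory Submission
  imports Defs
begin

text \<open>
  Let \<open>K f s = E (f (s + \<xi>); \<eta> \<le> x - s)\<close> be the transition operator of the walk killed at its first
  passage, so that \<open>P (\<tau>(x) > n) = (K^n 1)(0)\<close> and finiteness of the exponential moment amounts to that of
  \<open>G(0)\<close>, where \<open>G = \<Sum>n. e^(a n) K^n 1\<close>. Then \<open>G\<close> is finite where \<open>V \<ge> c + e^a K V\<close> has a finite solution
  \<open>V \<ge> 0\<close>, and \<open>G = \<infinity>\<close> where a bounded \<open>w \<ge> 0\<close> with \<open>w \<le> e^a K w\<close> is positive.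

  The condition \<open>R \<ge> a\<close> means that \<open>E e^(- t \<xi>) \<le> e^(-a)\<close> for some \<open>t \<ge> 0\<close>: the infimum is attained, by
  Fatou's lemma. Given such a \<open>t\<close>, \<open>V(s) = (e^(- t s) - \<kappa>)^+ + \<delta> \<kappa>\<close> with a small \<open>\<kappa>\<close> is a supersolution for
  every level. Conversely, if \<open>G(0) < \<infinity>\<close>, then \<open>G\<close> is finite everywhere, because \<open>P (\<xi> < 0, \<eta> \<le> x) > 0\<close>
  lets the walk descend. For the law truncated to \<open>|\<xi>| \<le> B, \<eta> \<le> B\<close> an exponentially tilted sine of small
  frequency is nearly an eigenfunction of \<open>K\<close> far to the left, with eigenvalue close to the truncated
  Laplace transform at the tilt. That transform is therefore at most about \<open>e^(-a)\<close> at some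
  \<open>t \<ge> 0\<close>, and \<open>B\<close> tends to infinity. The ladder epoch is the first passage time for \<open>\<eta> = \<xi>\<close> at level 0.
\<close>

section \<open>Super- and subsolutions for the killed walk\<close>

text \<open>The perturbation is tested against the position before the step. Values in
  \<open>ennreal\<close> make every integral meaningful and let a supersolution be infinite on a set
  that the walk avoids.\<close>

definition killed_step :: "'a measure \<Rightarrow> ('a \<Rightarrow> real) \<Rightarrow> ('a \<Rightarrow> real) \<Rightarrow> real \<Rightarrow> (real \<Rightarrow> ennreal) \<Rightarrow> real \<Rightarrow> ennreal" where
  "killed_step M X Y x f s = (\<integral>\<^sup>+\<omega>. indicator {..x - s} (Y \<omega>) * f (s + X \<omega>) \<partial>M)"

definition survival :: "'a measure \<Rightarrow> ('a \<Rightarrow> real) \<Rightarrow> ('a \<Rightarrow> real) \<Rightarrow> real \<Rightarrow> nat \<Rightarrow> real \<Rightarrow> ennreal" where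
  "survival M X Y x n = (killed_step M X Y x ^^ n) (\<lambda>_. 1)"

definition green :: "'a measure \<Rightarrow> ('a \<Rightarrow> real) \<Rightarrow> ('a \<Rightarrow> real) \<Rightarrow> real \<Rightarrow> real \<Rightarrow> real \<Rightarrow> ennreal" where
  "green M X Y x a s = (\<Sum>n. ennreal (exp a) ^ n * survival M X Y x n s)"

lemma survival_0 [simp]: "survival M X Y x 0 s = 1"
  by (simp add: survival_def)

lemma survival_Suc: "survival M X Y x (Suc n) = killed_step M X Y x (survival M X Y x n)"
  by (simp add: survival_def)

lemma killed_step_mono: "(\<And>s. f s \<le> g s) \<Longrightarrow> killed_step M X Y x f s \<le> killed_step M X Y x g s"
  unfolding killed_step_def by (intro nn_integral_mono mult_left_mono) auto

context prob_space
begin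

lemma killed_step_measurable [measurable]:
  assumes [measurable]: "random_variable borel X" "random_variable borel Y" "f \<in> borel_measurable borel"
  shows "killed_step M X Y x f \<in> borel_measurable borel"
proof -
  have [measurable]: "Measurable.pred (borel \<Otimes>\<^sub>M M) (\<lambda>(s, \<omega>). Y \<omega> \<in> {..x - s})"
    by (simp add: atMost_iff) measurable
  show ?thesis
    unfolding killed_step_def[abs_def] by measurable
qed

lemma survival_measurable [measurable]:
  assumes [measurable]: "random_variable borel X" "random_variable borel Y"
  shows "survival M X Y x n \<in> borel_measurable borel"
  by (induction n) (auto simp: survival_def)

text \<open>Lowering the start lowers the whole path, so every step faces a weaker condition
  \<open>Y \<le> x - s\<close>.\<close>

lemma survival_antimono:
  assumes "s \<le> t"
  shows "survival M X Y x n t \<le> survival M X Y x n s"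
  using assms
proof (induction n arbitrary: s t)
  case (Suc n)
  then show ?case
    unfolding survival_Suc killed_step_def
    by (intro nn_integral_mono mult_mono Suc.IH) (auto simp: indicator_def)
qed simp

lemma green_antimono: "s \<le> t \<Longrightarrow> green M X Y x a t \<le> green M X Y x a s"
  unfolding green_def by (intro suminf_le mult_left_mono survival_antimono) auto

text \<open>Decomposition at the first step, for partial sums, so that the comparison with a
  supersolution can go by induction.\<close>

lemma green_partial_Suc:
  fixes n :: nat
  assumes [measurable]: "random_variable borel X" "random_variable borel Y"
  shows "(\<Sum>k<Suc n. c ^ k * survival M X Y x k s) =
         1 + c * killed_step M X Y x (\<lambda>s. \<Sum>k<n. c ^ k * survival M X Y x k s) s"
proof -
  have "killed_step M X Y x (\<lambda>s. \<Sum>k<n. c ^ k * survival M X Y x k s) s =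
        (\<Sum>k<n. c ^ k * survival M X Y x (Suc k) s)"
    unfolding survival_Suc unfolding killed_step_def
    by (simp add: sum_distrib_left nn_integral_sum nn_integral_cmult mult.left_commute[of "indicator _ _"])
  then show ?thesis
    by (simp add: sum.lessThan_Suc_shift sum_distrib_left mult.assoc del: sum.lessThan_Suc)
qed

text \<open>Minimality of the Green function: \<open>c\<close> times each partial sum stays below
  \<open>V\<close>, because \<open>K\<close> is monotone and the supersolution inequality absorbs
  one more step. The bound then passes to the supremum.\<close>

lemma green_le_supersolution:
  assumes [measurable]: "random_variable borel X" "random_variable borel Y"
    and V: "\<And>s. c + ennreal (exp a) * killed_step M X Y x V s \<le> V s"
    and [measurable]: "V \<in> borel_measurable borel"
  shows "c * green M X Y x a s \<le> V s"
proof -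
  have "c * (\<Sum>k<n. ennreal (exp a) ^ k * survival M X Y x k s) \<le> V s" for n s
  proof (induction n arbitrary: s)
    case (Suc n)
    let ?g = "\<lambda>s. \<Sum>k<n. ennreal (exp a) ^ k * survival M X Y x k s"
    have "c * killed_step M X Y x ?g s = killed_step M X Y x (\<lambda>s. c * ?g s) s"
      unfolding killed_step_def by (simp add: nn_integral_cmult[symmetric] mult_ac)
    also have "\<dots> \<le> killed_step M X Y x V s"
      by (intro killed_step_mono Suc.IH)
    finally have "c + ennreal (exp a) * (c * killed_step M X Y x ?g s)
                    \<le> c + ennreal (exp a) * killed_step M X Y x V s"
      by (intro add_left_mono mult_left_mono) auto
    also have "\<dots> \<le> V s" by (rule V)
    finally show ?case
      unfolding green_partial_Suc[OF assms(1,2)] by (simp add: distrib_left mult_ac)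
  qed simp
  then show ?thesis
    unfolding green_def suminf_eq_SUP SUP_mult_left_ennreal by (intro SUP_least)
qed

lemma green_finite_of_supersolution:
  assumes "random_variable borel X" "random_variable borel Y" "V \<in> borel_measurable borel"
    and "\<And>s. c + ennreal (exp a) * killed_step M X Y x V s \<le> V s"
    and "c > 0" "V s < \<infinity>"
  shows "green M X Y x a s < \<infinity>"
proof -
  have "c * green M X Y x a s < \<infinity>"
    using green_le_supersolution[OF assms(1,2,4,3), of s] assms(6) by auto
  with \<open>c > 0\<close> show ?thesis
    by (auto simp: ennreal_mult_less_top)
qed

text \<open>Iteration gives l^n w \<le> K^n w, and w \<le> 1 bounds this by K^n 1. As e^a l \<ge> 1,
  every term of the Green series is at least w s > 0, so the series diverges.\<close>

lemma green_infinite_of_subsolution: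
  assumes "\<And>s. w s \<le> 1" "\<And>s. l * w s \<le> killed_step M X Y x w s"
    and l: "1 \<le> ennreal (exp a) * l" and "0 < w s"
    and [measurable]: "random_variable borel X" "random_variable borel Y"
    and [measurable]: "w \<in> borel_measurable borel"
  shows "green M X Y x a s = \<infinity>"
proof -
  have *: "l ^ n * w s \<le> survival M X Y x n s" for n s
  proof (induction n arbitrary: s)
    case (Suc n)
    have "l ^ Suc n * w s \<le> l ^ n * killed_step M X Y x w s"
      using mult_left_mono[OF assms(2), of "l ^ n" s] by (simp add: mult_ac)
    also have "\<dots> = killed_step M X Y x (\<lambda>s. l ^ n * w s) s"
      unfolding killed_step_def by (simp add: nn_integral_cmult[symmetric] mult_ac)
    also have "\<dots> \<le> survival M X Y x (Suc n) s"
      unfolding survival_Suc by (intro killed_step_mono Suc.IH)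
    finally show ?case .
  qed (use assms(1) in simp)
  have "w s \<le> ennreal (exp a) ^ n * survival M X Y x n s" for n
  proof -
    have "1 * w s \<le> (ennreal (exp a) * l) ^ n * w s"
      using l by (intro mult_right_mono one_le_power) auto
    also have "\<dots> = ennreal (exp a) ^ n * (l ^ n * w s)"
      by (simp add: power_mult_distrib mult_ac)
    also have "\<dots> \<le> ennreal (exp a) ^ n * survival M X Y x n s"
      by (intro mult_left_mono *) auto
    finally show ?thesis by simp
  qed
  then have "(\<Sum>n::nat. w s) \<le> green M X Y x a s"
    unfolding green_def by (intro suminf_le) auto
  moreover have "(\<Sum>n::nat. w s) = \<infinity>"
    using \<open>0 < w s\<close> by (simp add: nn_integral_count_space_nat[symmetric] ennreal_mult_eq_top_iff)
  ultimately show ?thesis by (simp add: top_unique)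
qed

text \<open>Only first steps down by at least \<open>d\<close> are kept. For s \<le> 0 the event Y
  \<le> x already implies survival of that step, and from the new position, at or below s - d,
  survival is at least as likely as from s - d.\<close>

lemma survival_Suc_ge:
  assumes [measurable]: "random_variable borel X" "random_variable borel Y"
    and "s \<le> 0"
  shows "ennreal (\<P>(\<omega> in M. X \<omega> \<le> -d \<and> Y \<omega> \<le> x)) * survival M X Y x n (s - d)
           \<le> survival M X Y x (Suc n) s"
proof -
  let ?A = "{\<omega>\<in>space M. X \<omega> \<le> -d \<and> Y \<omega> \<le> x}"
  have "ennreal (prob ?A) * survival M X Y x n (s - d) =
          (\<integral>\<^sup>+\<omega>. indicator ?A \<omega> * survival M X Y x n (s - d) \<partial>M)"
    by (simp add: nn_integral_multc emeasure_eq_measure)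
  also have "\<dots> \<le> survival M X Y x (Suc n) s"
    unfolding survival_Suc killed_step_def
    using \<open>s \<le> 0\<close> by (intro nn_integral_mono)
      (auto simp: indicator_def intro!: survival_antimono)
  finally show ?thesis .
qed

text \<open>Finiteness spreads from 0 to -d, -2d and so on, because each descent costs only a
  positive factor e^a p. Antitonicity in the start then reaches every \<open>s\<close>.\<close>

lemma green_finite_left:
  assumes [measurable]: "random_variable borel X" "random_variable borel Y"
    and "d > 0" and p: "\<P>(\<omega> in M. X \<omega> \<le> -d \<and> Y \<omega> \<le> x) > 0"
    and "green M X Y x a 0 < \<infinity>"
  shows "green M X Y x a s < \<infinity>"
proof -
  let ?p = "ennreal (\<P>(\<omega> in M. X \<omega> \<le> -d \<and> Y \<omega> \<le> x))" and ?A = "ennreal (exp a)"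
  have step: "?A * ?p * green M X Y x a (s - d) \<le> green M X Y x a s" if "s \<le> 0" for s
  proof -
    have "?A * ?p * green M X Y x a (s - d) =
          (\<Sum>n. ?A ^ Suc n * (?p * survival M X Y x n (s - d)))"
      unfolding green_def by (subst ennreal_suminf_cmult[symmetric]) (simp add: mult_ac)
    also have "\<dots> \<le> (\<Sum>n. ?A ^ Suc n * survival M X Y x (Suc n) s)"
      using that by (intro suminf_le mult_left_mono survival_Suc_ge) auto
    \<comment> \<open>The left side is the Green series without its term for n = 0.\<close>
    also have "\<dots> \<le> (\<Sum>n. ?A ^ n * survival M X Y x n s)"
      by (subst (2) suminf_offset[OF summableI, where i = 1]) (auto simp: add_increasing2)
    finally show ?thesis by (simp add: green_def)
  qed
  have "green M X Y x a (- real k * d) < \<infinity>" for k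
  proof (induction k)
    case (Suc k)
    have "?A * ?p * green M X Y x a (- real k * d - d) < \<infinity>"
      using step[of "- real k * d"] Suc \<open>d > 0\<close> by (auto simp: mult_nonneg_nonneg)
    moreover have "- real k * d - d = - real (Suc k) * d"
      by (simp add: algebra_simps)
    ultimately show ?case
      using p by (auto simp: ennreal_mult_less_top simp del: of_nat_Suc)
  qed (use assms in simp)
  moreover obtain k :: nat where "- s / d \<le> real k"
    using real_arch_simple by blast
  then have "- real k * d \<le> s"
    using \<open>d > 0\<close> by (simp add: field_simps)
  ultimately show ?thesis
    using green_antimono order_le_less_trans by blast
qed

end

section \<open>First passage times and the killed walk\<close>

text \<open>Tonelli for the product law of an independent pair. The independent copy in the inner
  integral lives on the same space \<open>M\<close>, so that the inner integral can be read as a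
  transition operator.\<close>

lemma (in prob_space) nn_integral_indep_var:
  assumes ind: "indep_var S X T Y" and [measurable]: "case_prod F \<in> borel_measurable (S \<Otimes>\<^sub>M T)"
  shows "(\<integral>\<^sup>+\<omega>. F (X \<omega>) (Y \<omega>) \<partial>M) = (\<integral>\<^sup>+\<omega>. (\<integral>\<^sup>+\<omega>'. F (X \<omega>) (Y \<omega>') \<partial>M) \<partial>M)"
proof -
  have [measurable]: "random_variable S X" "random_variable T Y"
    using ind by (auto dest: indep_var_rv1 indep_var_rv2)
  interpret S: prob_space "distr M S X" by (rule prob_space_distr) simp
  interpret T: prob_space "distr M T Y" by (rule prob_space_distr) simp
  have "(\<integral>\<^sup>+\<omega>. F (X \<omega>) (Y \<omega>) \<partial>M) = (\<integral>\<^sup>+p. case_prod F p \<partial>distr M (S \<Otimes>\<^sub>M T) (\<lambda>\<omega>. (X \<omega>, Y \<omega>)))"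
    by (subst nn_integral_distr) auto
  also have "\<dots> = (\<integral>\<^sup>+p. case_prod F p \<partial>(distr M S X \<Otimes>\<^sub>M distr M T Y))"
    using ind by (simp add: indep_var_distribution_eq)
  also have "\<dots> = (\<integral>\<^sup>+u. (\<integral>\<^sup>+v. F u v \<partial>distr M T Y) \<partial>distr M S X)"
    by (subst T.nn_integral_fst[symmetric]) (auto cong: measurable_cong_sets)
  also have "\<dots> = (\<integral>\<^sup>+\<omega>. (\<integral>\<^sup>+\<omega>'. F (X \<omega>) (Y \<omega>') \<partial>M) \<partial>M)"
    by (subst nn_integral_distr, simp, measurable, intro nn_integral_cong, subst nn_integral_distr)
       (auto dest: measurable_space)
  finally show ?thesis .
qed

lemma ennreal_geometric_plus_1:
  assumes "a > 0"
  shows "ennreal (exp (a * real k)) = 1 + ennreal (exp a - 1) * (\<Sum>n<k. ennreal (exp a) ^ n)"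
proof -
  have "(\<Sum>n<k. ennreal (exp a) ^ n) = ennreal (\<Sum>n<k. exp a ^ n)"
    by (simp add: ennreal_power[symmetric] flip: sum_ennreal)
  moreover have "exp (a * real k) = 1 + (exp a - 1) * (\<Sum>n<k. exp a ^ n)"
    using assms power_diff_1_eq[of "exp a" k] by (simp add: exp_of_nat2_mult)
  ultimately show ?thesis
    using assms by (simp add: ennreal_mult''[symmetric] sum_nonneg)
qed

text \<open>Geometric summation turns the moment into a series of tails n < N. For N = \<infinity>
  both sides are infinite, since a > 0 makes the geometric series diverge and its factor
  positive.\<close>

lemma exp_enat_eq_sum:
  assumes "a > 0"
  shows "exp_enat a N =
    1 + ennreal (exp a - 1) * (\<Sum>n. ennreal (exp a) ^ n * (if enat n < N then 1 else 0))"
proof (cases N)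
  case (enat k)
  have "(\<Sum>n. ennreal (exp a) ^ n * (if enat n < N then 1 else 0)) =
        (\<Sum>n<k. ennreal (exp a) ^ n * (if enat n < N then 1 else 0))"
    by (intro suminf_finite) (auto simp: enat)
  also have "\<dots> = (\<Sum>n<k. ennreal (exp a) ^ n)"
    by (intro sum.cong) (auto simp: enat)
  finally show ?thesis
    unfolding enat exp_enat_def by (simp add: ennreal_geometric_plus_1[OF assms])
next
  case infinity
  have "(\<Sum>n::nat. 1::ennreal) \<le> (\<Sum>n. ennreal (exp a) ^ n)"
    using assms by (intro suminf_le one_le_power) auto
  moreover have "(\<Sum>n::nat. 1::ennreal) = \<infinity>"
    by (simp add: nn_integral_count_space_nat[symmetric])
  ultimately show ?thesis
    using assms by (simp add: infinity exp_enat_def top_unique ennreal_mult_eq_top_iff)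
qed

lemma less_INF_enat_iff: "enat n < (INF k\<in>A. enat k) \<longleftrightarrow> (\<forall>k\<in>A. n < k)"
proof
  assume "enat n < (INF k\<in>A. enat k)"
  then show "\<forall>k\<in>A. n < k"
    by (metis INF_lower enat_ord_simps(2) order_less_le_trans)
next
  assume "\<forall>k\<in>A. n < k"
  then have "enat (Suc n) \<le> (INF k\<in>A. enat k)"
    by (intro INF_greatest) auto
  then show "enat n < (INF k\<in>A. enat k)"
    using Suc_ile_eq by blast
qed

lemma less_first_passage_iff:
  "enat n < first_passage \<xi> \<eta> x \<omega> \<longleftrightarrow> (\<forall>k\<in>{1..n}. perturbed_walk \<xi> \<eta> k \<omega> \<le> x)"
  unfolding first_passage_def less_INF_enat_iff by (auto simp: not_le[symmetric])

lemma ladder_epoch_eq_first_passage: "ladder_epoch \<xi> = first_passage \<xi> \<xi> 0"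
proof -
  have "walk \<xi> n \<omega> = perturbed_walk \<xi> \<xi> n \<omega>" if "1 \<le> n" for n \<omega>
    using that by (cases n) (auto simp: perturbed_walk_def walk_def)
  then have "{n. 1 \<le> n \<and> walk \<xi> n \<omega> > 0} = {n. 1 \<le> n \<and> perturbed_walk \<xi> \<xi> n \<omega> > 0}" for \<omega>
    by auto
  then show ?thesis
    by (auto simp: ladder_epoch_def first_passage_def fun_eq_iff)
qed

text \<open>The pairs are measurable into the Borel sets of the plane rather than into a product
  sigma-algebra, so projections are handled through continuity.\<close>

lemma fst_borel_measurable: "fst \<in> borel_measurable (borel :: ('a :: second_countable_topology \<times> 'b :: second_countable_topology) measure)"
  by (intro borel_measurable_continuous_onI continuous_on_fst continuous_on_id)

lemma snd_borel_measurable: "snd \<in> borel_measurable (borel :: ('a :: second_countable_topology \<times> 'b :: second_countable_topology) measure)"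
  by (intro borel_measurable_continuous_onI continuous_on_snd continuous_on_id)

section \<open>The Markov property and the tail of the first passage time\<close>

context perturbed_random_walk
begin

lemma pair_measurable: "random_variable borel (\<lambda>\<omega>. (\<xi> n \<omega>, \<eta> n \<omega>))"
  using indep_pairs by (auto simp: indep_vars_def)

lemma xi_measurable [measurable]: "random_variable borel (\<xi> n)"
  using measurable_compose[OF pair_measurable fst_borel_measurable] by simp

lemma eta_measurable [measurable]: "random_variable borel (\<eta> n)"
  using measurable_compose[OF pair_measurable snd_borel_measurable] by simp

lemma walk_measurable [measurable]: "random_variable borel (walk \<xi> n)"
  unfolding walk_def by measurable

lemma perturbed_walk_measurable [measurable]: "random_variable borel (perturbed_walk \<xi> \<eta> n)"
  unfolding perturbed_walk_def by measurable

lemma nn_integral_pair_shift: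
  assumes [measurable]: "case_prod F \<in> borel_measurable (borel \<Otimes>\<^sub>M borel)"
  shows "(\<integral>\<^sup>+\<omega>. F (\<xi> n \<omega>) (\<eta> n \<omega>) \<partial>M) = (\<integral>\<^sup>+\<omega>. F (\<xi> 0 \<omega>) (\<eta> 0 \<omega>) \<partial>M)"
proof -
  have [measurable]: "case_prod F \<in> borel_measurable borel"
    using assms by (simp add: borel_prod)
  have "(\<integral>\<^sup>+\<omega>. F (\<xi> n \<omega>) (\<eta> n \<omega>) \<partial>M) = (\<integral>\<^sup>+p. case_prod F p \<partial>distr M borel (\<lambda>\<omega>. (\<xi> n \<omega>, \<eta> n \<omega>)))" for n
    by (subst nn_integral_distr) (auto simp: pair_measurable)
  then show ?thesis
    using identically_distributed[of n] by metis
qed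

text \<open>The past depends only on the pairs with indices in \<open>{1..n}\<close>, the next step
  only on the pair \<open>Suc n\<close>, and disjoint blocks of an independent family are
  independent. The survival event enters as a real 0-1 variable, which makes the past a random
  vector in the plane.\<close>

lemma indep_var_past_step:
  fixes x :: real
  shows "indep_var (borel \<Otimes>\<^sub>M borel)
           (\<lambda>\<omega>. (walk \<xi> n \<omega>, if \<forall>k\<in>{1..n}. perturbed_walk \<xi> \<eta> k \<omega> \<le> x then 1 else 0 :: real))
           (borel \<Otimes>\<^sub>M borel) (\<lambda>\<omega>. (\<xi> (Suc n) \<omega>, \<eta> (Suc n) \<omega>))"
proof -
  let ?P = "PiM {1..n} (\<lambda>_. borel :: (real \<times> real) measure)"
  let ?X = "\<lambda>I \<omega>. restrict (\<lambda>i. (\<xi> i \<omega>, \<eta> i \<omega>)) I"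
  \<comment> \<open>\<open>W\<close> and \<open>g\<close> recompute the walk and the survival
    indicator from the coordinate tuple, so that the past becomes a measurable function of the
    restricted family.\<close>
  define W where "W k z = (\<Sum>i=1..k. fst (z i))" for k and z :: "nat \<Rightarrow> real \<times> real"
  define g where "g z = (W n z, if \<forall>k\<in>{1..n}. W (k - 1) z + snd (z k) \<le> x then 1 else 0 :: real)" for z
  have comp: "(\<lambda>z. fst (z i)) \<in> borel_measurable ?P" "(\<lambda>z. snd (z i)) \<in> borel_measurable ?P"
    if "i \<in> {1..n}" for i
    using measurable_compose[OF measurable_component_singleton[OF that] fst_borel_measurable]
      measurable_compose[OF measurable_component_singleton[OF that] snd_borel_measurable]
    by blast+
  have W: "W k \<in> borel_measurable ?P" if "k \<le> n" for k
    unfolding W_def[abs_def] using that by (intro borel_measurable_sum comp) auto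
  have "Measurable.pred ?P (\<lambda>z. W (k - 1) z + snd (z k) \<le> x)" if "k \<in> {1..n}" for k
  proof -
    have [measurable]: "W (k - 1) \<in> borel_measurable ?P" "(\<lambda>z. snd (z k)) \<in> borel_measurable ?P"
      using W[of "k - 1"] comp(2)[OF that] that by auto
    show ?thesis by measurable
  qed
  then have [measurable]: "Measurable.pred ?P (\<lambda>z. \<forall>k\<in>{1..n}. W (k - 1) z + snd (z k) \<le> x)"
    by (intro pred_intros_finite) auto
  have "g \<in> measurable ?P (borel \<Otimes>\<^sub>M borel)"
    unfolding g_def[abs_def] using W[of n] by measurable
  moreover have "(\<lambda>z. z (Suc n)) \<in> measurable (PiM {Suc n} (\<lambda>_. borel :: (real \<times> real) measure)) (borel \<Otimes>\<^sub>M borel)"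
    unfolding borel_prod by (intro measurable_component_singleton) auto
  moreover have "indep_var ?P (?X {1..n}) (PiM {Suc n} (\<lambda>_. borel :: (real \<times> real) measure)) (?X {Suc n})"
    by (rule indep_var_restrict[OF indep_pairs]) auto
  ultimately have "indep_var (borel \<Otimes>\<^sub>M borel) (g \<circ> ?X {1..n}) (borel \<Otimes>\<^sub>M borel) ((\<lambda>z. z (Suc n)) \<circ> ?X {Suc n})"
    using indep_var_compose by blast
  moreover have "g \<circ> ?X {1..n} = (\<lambda>\<omega>. (walk \<xi> n \<omega>, if \<forall>k\<in>{1..n}. perturbed_walk \<xi> \<eta> k \<omega> \<le> x then 1 else 0))"
  proof
    fix \<omega>
    have W_walk: "W k (?X {1..n} \<omega>) = walk \<xi> k \<omega>" if "k \<le> n" for k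
      unfolding W_def walk_def using that by (intro sum.cong) auto
    have eq: "W (k - 1) (?X {1..n} \<omega>) + snd (?X {1..n} \<omega> k) = perturbed_walk \<xi> \<eta> k \<omega>" if k: "k \<in> {1..n}" for k
    proof -
      have "k - 1 \<le> n" using k by auto
      then have "W (k - 1) (?X {1..n} \<omega>) = walk \<xi> (k - 1) \<omega>" by (rule W_walk)
      then show ?thesis
        unfolding perturbed_walk_def restrict_apply'[OF k] snd_conv by (rule arg_cong)
    qed
    have iff: "(\<forall>k\<in>{1..n}. W (k - 1) (?X {1..n} \<omega>) + snd (?X {1..n} \<omega> k) \<le> x) \<longleftrightarrow>
        (\<forall>k\<in>{1..n}. perturbed_walk \<xi> \<eta> k \<omega> \<le> x)"
      by (rule ball_cong[OF refl], subst eq, assumption, rule refl)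
    show "(g \<circ> ?X {1..n}) \<omega> =
        (walk \<xi> n \<omega>, if \<forall>k\<in>{1..n}. perturbed_walk \<xi> \<eta> k \<omega> \<le> x then 1 else 0)"
      unfolding g_def comp_apply iff W_walk[OF order_refl] ..
  qed
  ultimately show ?thesis by (simp add: comp_def)
qed

text \<open>The Markov property: integrating out the last step replaces \<open>f\<close> by
  \<open>K f\<close> one time unit earlier. This is why the induction runs over arbitrary
  \<open>f\<close>.\<close>

lemma nn_integral_walk_survival:
  assumes "f \<in> borel_measurable borel"
  shows "(\<integral>\<^sup>+\<omega>. (if \<forall>k\<in>{1..n}. perturbed_walk \<xi> \<eta> k \<omega> \<le> x then 1 else 0) * f (walk \<xi> n \<omega>) \<partial>M) =
         (killed_step M (\<xi> 0) (\<eta> 0) x ^^ n) f 0"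
  using assms
proof (induction n arbitrary: f)
  case 0
  then show ?case by (simp add: walk_def emeasure_space_1)
next
  case (Suc n)
  note [measurable] = Suc.prems
  let ?A = "\<lambda>n \<omega>. if \<forall>k\<in>{1..n}. perturbed_walk \<xi> \<eta> k \<omega> \<le> x then 1 else 0 :: real"
  let ?K = "killed_step M (\<xi> 0) (\<eta> 0) x"
  \<comment> \<open>Here \<open>p\<close> holds the present position and the survival indicator,
    \<open>q\<close> the next step and its perturbation.\<close>
  define F where "F p q = ennreal (snd p) * (indicator {..x - fst p} (snd q) * f (fst p + fst q))"
    for p q :: "real \<times> real"
  have [measurable]: "case_prod F \<in> borel_measurable ((borel \<Otimes>\<^sub>M borel) \<Otimes>\<^sub>M (borel \<Otimes>\<^sub>M borel))"
    unfolding F_def[abs_def] atMost_iff indicator_def by measurable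
  have "(\<integral>\<^sup>+\<omega>. ennreal (?A (Suc n) \<omega>) * f (walk \<xi> (Suc n) \<omega>) \<partial>M) =
        (\<integral>\<^sup>+\<omega>. F (walk \<xi> n \<omega>, ?A n \<omega>) (\<xi> (Suc n) \<omega>, \<eta> (Suc n) \<omega>) \<partial>M)"
    by (intro nn_integral_cong)
       (auto simp: F_def atLeastAtMostSuc_conv perturbed_walk_def walk_def indicator_def algebra_simps)
  also have "\<dots> = (\<integral>\<^sup>+\<omega>. (\<integral>\<^sup>+\<omega>'. F (walk \<xi> n \<omega>, ?A n \<omega>) (\<xi> (Suc n) \<omega>', \<eta> (Suc n) \<omega>') \<partial>M) \<partial>M)"
    by (rule nn_integral_indep_var[OF indep_var_past_step[of n x], of F]) measurable
  also have "\<dots> = (\<integral>\<^sup>+\<omega>. ennreal (?A n \<omega>) * ?K f (walk \<xi> n \<omega>) \<partial>M)"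
  proof (intro nn_integral_cong)
    fix \<omega>
    have "(\<integral>\<^sup>+\<omega>'. F (walk \<xi> n \<omega>, ?A n \<omega>) (\<xi> (Suc n) \<omega>', \<eta> (Suc n) \<omega>') \<partial>M) =
      ennreal (?A n \<omega>) * (\<integral>\<^sup>+\<omega>'. indicator {..x - walk \<xi> n \<omega>} (\<eta> (Suc n) \<omega>') * f (walk \<xi> n \<omega> + \<xi> (Suc n) \<omega>') \<partial>M)"
      by (simp add: F_def nn_integral_cmult)
    also have "(\<integral>\<^sup>+\<omega>'. indicator {..x - walk \<xi> n \<omega>} (\<eta> (Suc n) \<omega>') * f (walk \<xi> n \<omega> + \<xi> (Suc n) \<omega>') \<partial>M) =
        ?K f (walk \<xi> n \<omega>)"
      unfolding killed_step_def
      by (rule nn_integral_pair_shift[where F = "\<lambda>u v. indicator {..x - walk \<xi> n \<omega>} v * f (walk \<xi> n \<omega> + u)"]) measurable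
    finally show "(\<integral>\<^sup>+\<omega>'. F (walk \<xi> n \<omega>, ?A n \<omega>) (\<xi> (Suc n) \<omega>', \<eta> (Suc n) \<omega>') \<partial>M) =
        ennreal (?A n \<omega>) * ?K f (walk \<xi> n \<omega>)" .
  qed
  also have "\<dots> = (?K ^^ Suc n) f 0"
    using Suc.IH[of "?K f"] by (simp add: if_distrib[of ennreal] funpow_swap1 cong: if_cong)
  finally show ?case by (simp add: if_distrib[of ennreal] cong: if_cong)
qed

text \<open>The tail expansion of the exponential is integrated term by term; the n-th tail
  probability is K^n 1 at 0.\<close>

lemma exp_moment_first_passage:
  assumes "a > 0"
  shows "exp_moment M a (first_passage \<xi> \<eta> x) =
         1 + ennreal (exp a - 1) * green M (\<xi> 0) (\<eta> 0) x a 0"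
proof -
  have [measurable]: "Measurable.pred M (\<lambda>\<omega>. \<forall>k\<in>{1..n}. perturbed_walk \<xi> \<eta> k \<omega> \<le> x)" for n
    by measurable
  have "exp_moment M a (first_passage \<xi> \<eta> x) =
    (\<integral>\<^sup>+\<omega>. 1 + ennreal (exp a - 1) * (\<Sum>n. ennreal (exp a) ^ n *
       (if \<forall>k\<in>{1..n}. perturbed_walk \<xi> \<eta> k \<omega> \<le> x then 1 else 0)) \<partial>M)"
    unfolding exp_moment_def exp_enat_eq_sum[OF assms] less_first_passage_iff ..
  also have "\<dots> = 1 + ennreal (exp a - 1) * (\<Sum>n. ennreal (exp a) ^ n *
       (\<integral>\<^sup>+\<omega>. (if \<forall>k\<in>{1..n}. perturbed_walk \<xi> \<eta> k \<omega> \<le> x then 1 else 0) * 1 \<partial>M))"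
    by (simp add: nn_integral_add nn_integral_cmult nn_integral_suminf emeasure_space_1)
  also have "\<dots> = 1 + ennreal (exp a - 1) * green M (\<xi> 0) (\<eta> 0) x a 0"
    unfolding green_def survival_def by (subst nn_integral_walk_survival) auto
  finally show ?thesis .
qed

lemma exp_moment_first_passage_finite_iff:
  assumes "a > 0"
  shows "exp_moment M a (first_passage \<xi> \<eta> x) < \<infinity> \<longleftrightarrow> green M (\<xi> 0) (\<eta> 0) x a 0 < \<infinity>"
  using assms by (auto simp: exp_moment_first_passage ennreal_mult_less_top)

text \<open>The pairs are pushed forward under the map from (u, v) to (u, u), which preserves
  independence and equality of laws. This lets the ladder epoch be treated as a first passage
  time.\<close>

lemma perturbed_random_walk_self: "perturbed_random_walk M \<xi> \<xi>"
proof unfold_locales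
  have dup: "(\<lambda>p. (fst p, fst p)) \<in> measurable borel (borel :: (real \<times> real) measure)"
    by (intro borel_measurable_continuous_onI continuous_intros)
  show "indep_vars (\<lambda>_. borel :: (real \<times> real) measure) (\<lambda>n \<omega>. (\<xi> n \<omega>, \<xi> n \<omega>)) UNIV"
    using indep_vars_compose2[OF indep_pairs dup] by simp
  have "distr M borel (\<lambda>\<omega>. (\<xi> n \<omega>, \<xi> n \<omega>)) =
      distr (distr M borel (\<lambda>\<omega>. (\<xi> n \<omega>, \<eta> n \<omega>))) borel (\<lambda>p. (fst p, fst p))" for n
    by (subst distr_distr[OF dup pair_measurable]) (simp add: comp_def)
  then show "distr M (borel :: (real \<times> real) measure) (\<lambda>\<omega>. (\<xi> n \<omega>, \<xi> n \<omega>)) =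
      distr M borel (\<lambda>\<omega>. (\<xi> 0 \<omega>, \<xi> 0 \<omega>))" for n
    using identically_distributed[of n] by simp
qed (use xi_nondegenerate in auto)

end

section \<open>Supersolutions from the Laplace transform\<close>

context prob_space
begin

text \<open>A subsequence of the exponents converges in [0, \<infinity>], and Fatou's lemma bounds
  the limiting integral by \<open>c'\<close>. An infinite limit is impossible, as the integrand
  would blow up on the event X < 0 of positive probability. This serves both for minimising
  sequences, with \<open>A n\<close> the whole space, and for truncations exhausting the
  space.\<close>

lemma laplace_limit:
  fixes t :: "nat \<Rightarrow> real"
  assumes [measurable]: "random_variable borel X" "\<And>n. A n \<in> events"
    and neg: "\<P>(\<omega> in M. X \<omega> < 0) > 0"
    and A: "\<And>\<omega>. \<omega> \<in> space M \<Longrightarrow> eventually (\<lambda>n. \<omega> \<in> A n) sequentially"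
    and t: "\<And>n. t n \<ge> 0"
    and le: "\<And>n. (\<integral>\<^sup>+\<omega>. indicator (A n) \<omega> * ennreal (exp (- t n * X \<omega>)) \<partial>M) \<le> c n"
    and c: "c \<longlonglongrightarrow> c'" "c' < \<infinity>"
  shows "\<exists>t\<ge>0. (\<integral>\<^sup>+\<omega>. ennreal (exp (- t * X \<omega>)) \<partial>M) \<le> c'"
proof -
  obtain l r where r: "strict_mono r" and l: "((\<lambda>n. ereal (t n)) \<circ> r) \<longlonglongrightarrow> l"
    using compact_complete_linorder[of "\<lambda>n. ereal (t n)"] by blast
  define u where "u n \<omega> = indicator (A (r n)) \<omega> * ennreal (exp (- t (r n) * X \<omega>))" for n \<omega>
  have [measurable]: "u n \<in> borel_measurable M" for n
    unfolding u_def by measurable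
  have A_r: "eventually (\<lambda>n. indicator (A (r n)) \<omega> = (1::ennreal)) sequentially" if "\<omega> \<in> space M" for \<omega>
    using eventually_subseq[OF r A[OF that]] by eventually_elim simp
  have "(\<integral>\<^sup>+\<omega>. liminf (\<lambda>n. u n \<omega>) \<partial>M) \<le> liminf (\<lambda>n. \<integral>\<^sup>+\<omega>. u n \<omega> \<partial>M)"
    by (rule nn_integral_liminf) measurable
  also have "\<dots> \<le> liminf (\<lambda>n. c (r n))"
    by (intro Liminf_mono always_eventually allI) (unfold u_def, rule le)
  also have "\<dots> = c'"
    using LIMSEQ_subseq_LIMSEQ[OF c(1) r] by (intro lim_imp_Liminf) (auto simp: comp_def)
  finally have fatou: "(\<integral>\<^sup>+\<omega>. liminf (\<lambda>n. u n \<omega>) \<partial>M) \<le> c'" .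
  have "0 \<le> l"
    using l t by (intro LIMSEQ_le_const[OF l]) auto
  show ?thesis
  proof (cases l)
    case (real t')
    then have t': "(\<lambda>n. t (r n)) \<longlonglongrightarrow> t'"
      using l by (simp add: comp_def)
    have "liminf (\<lambda>n. u n \<omega>) = ennreal (exp (- t' * X \<omega>))" if "\<omega> \<in> space M" for \<omega>
    proof (intro lim_imp_Liminf)
      have "(\<lambda>n. ennreal (exp (- t (r n) * X \<omega>))) \<longlonglongrightarrow> ennreal (exp (- t' * X \<omega>))"
        using t' by (intro tendsto_intros tendsto_ennrealI)
      moreover have "eventually (\<lambda>n. ennreal (exp (- t (r n) * X \<omega>)) = u n \<omega>) sequentially"
        using A_r[OF that] by eventually_elim (simp add: u_def)
      ultimately show "(\<lambda>n. u n \<omega>) \<longlonglongrightarrow> ennreal (exp (- t' * X \<omega>))"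
        by (rule Lim_transform_eventually)
    qed simp
    then have "(\<integral>\<^sup>+\<omega>. ennreal (exp (- t' * X \<omega>)) \<partial>M) = (\<integral>\<^sup>+\<omega>. liminf (\<lambda>n. u n \<omega>) \<partial>M)"
      by (intro nn_integral_cong) simp
    with fatou show ?thesis
      using \<open>0 \<le> l\<close> real by (intro exI[of _ t']) auto
  next
    case PInf
    then have t_top: "filterlim (\<lambda>n. t (r n)) at_top sequentially"
      using l by (simp add: comp_def tendsto_PInfty_eq_at_top)
    have "liminf (\<lambda>n. u n \<omega>) = \<infinity>" if "\<omega> \<in> space M" "X \<omega> < 0" for \<omega>
    proof (intro lim_imp_Liminf)
      have "filterlim (\<lambda>n. exp (- X \<omega> * t (r n))) at_top sequentially"
        using that t_top by (intro filterlim_compose[OF exp_at_top] filterlim_tendsto_pos_mult_at_top[OF tendsto_const]) auto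
      then have "(\<lambda>n. ennreal (exp (- X \<omega> * t (r n)))) \<longlonglongrightarrow> \<infinity>"
        by (simp only: infinity_ennreal_def ennreal_tendsto_top_eq_at_top)
      moreover have "eventually (\<lambda>n. ennreal (exp (- X \<omega> * t (r n))) = u n \<omega>) sequentially"
        using A_r[OF that(1)] by eventually_elim (simp add: u_def mult.commute)
      ultimately show "(\<lambda>n. u n \<omega>) \<longlonglongrightarrow> \<infinity>"
        by (rule Lim_transform_eventually)
    qed simp
    then have "(\<integral>\<^sup>+\<omega>. \<infinity> * indicator {\<omega>\<in>space M. X \<omega> < 0} \<omega> \<partial>M) \<le> (\<integral>\<^sup>+\<omega>. liminf (\<lambda>n. u n \<omega>) \<partial>M)"
      by (intro nn_integral_mono) (auto simp: indicator_def)
    also have "\<dots> < \<infinity>"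
      using fatou c(2) by auto
    finally have "\<infinity> * emeasure M {\<omega>\<in>space M. X \<omega> < 0} < (\<infinity> :: ennreal)"
      by (subst (asm) nn_integral_cmult_indicator) auto
    then show ?thesis
      using neg by (simp add: emeasure_eq_measure ennreal_mult_less_top)
  qed (use \<open>0 \<le> l\<close> in auto)
qed

end

section \<open>The rate as a condition on the Laplace transform\<close>

lemma le_neg_ln_iff: "ereal a \<le> neg_ln u \<longleftrightarrow> u \<le> ennreal (exp (- a))"
proof (cases u)
  case (real r)
  show ?thesis
  proof (cases "r = 0")
    case False
    then have "r > 0" using real(1) by simp
    then have "ln r \<le> ln (exp (- a)) \<longleftrightarrow> r \<le> exp (- a)"
      by (intro ln_le_cancel_iff) auto
    then have "a \<le> - ln r \<longleftrightarrow> r \<le> exp (- a)"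
      by (simp add: le_minus_iff[of a])
    then show ?thesis
      using real False by (simp add: neg_ln_def)
  qed (use real in \<open>simp add: neg_ln_def\<close>)
qed (simp add: neg_ln_def top_unique)

text \<open>The infimum is attained: along near-minimisers with error 1/(n+1) the Fatou argument
  yields an exact solution, and the event X < 0 keeps the exponents from escaping to
  infinity.\<close>

lemma (in prob_space) le_exp_rate_iff:
  assumes [measurable]: "random_variable borel X" and neg: "\<P>(\<omega> in M. X \<omega> < 0) > 0"
  shows "ereal a \<le> exp_rate M X \<longleftrightarrow>
         (\<exists>t\<ge>0. (\<integral>\<^sup>+\<omega>. ennreal (exp (- t * X \<omega>)) \<partial>M) \<le> ennreal (exp (- a)))"
proof
  let ?\<phi> = "\<lambda>t. \<integral>\<^sup>+\<omega>. ennreal (exp (- t * X \<omega>)) \<partial>M"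
  assume "ereal a \<le> exp_rate M X"
  then have le: "(INF t\<in>{0..}. ?\<phi> t) \<le> ennreal (exp (- a))"
    by (simp add: exp_rate_def le_neg_ln_iff)
  have "\<exists>t\<in>{0..}. ?\<phi> t < ennreal (exp (- a) + 1 / real (Suc n))" for n
    using order_le_less_trans[OF le, of "ennreal (exp (- a) + 1 / real (Suc n))"]
    by (intro INF_less_iff[THEN iffD1]) (simp add: ennreal_less_iff)
  then obtain t where t: "\<And>n. t n \<ge> 0" "\<And>n. ?\<phi> (t n) < ennreal (exp (- a) + 1 / real (Suc n))"
    by (metis atLeast_iff)
  have "(\<lambda>n. exp (- a) + 1 / real (Suc n)) \<longlonglongrightarrow> exp (- a) + 0"
    by (intro tendsto_intros) (use LIMSEQ_inverse_real_of_nat in \<open>simp add: inverse_eq_divide\<close>)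
  then have "(\<lambda>n. ennreal (exp (- a) + 1 / real (Suc n))) \<longlonglongrightarrow> ennreal (exp (- a))"
    by (intro tendsto_ennrealI) simp
  moreover have "(\<integral>\<^sup>+\<omega>. indicator (space M) \<omega> * ennreal (exp (- t n * X \<omega>)) \<partial>M)
      \<le> ennreal (exp (- a) + 1 / real (Suc n))" for n
    using less_imp_le[OF t(2)[of n]] by (subst nn_integral_cong[of M _ "\<lambda>\<omega>. ennreal (exp (- t n * X \<omega>))"]) simp_all
  ultimately show "\<exists>t\<ge>0. ?\<phi> t \<le> ennreal (exp (- a))"
    using t(1) by (intro laplace_limit[OF assms(1) _ neg, where A = "\<lambda>_. space M" and t = t]) simp_all
next
  assume "\<exists>t\<ge>0. (\<integral>\<^sup>+\<omega>. ennreal (exp (- t * X \<omega>)) \<partial>M) \<le> ennreal (exp (- a))"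
  then show "ereal a \<le> exp_rate M X"
    unfolding exp_rate_def le_neg_ln_iff by (auto intro: INF_lower2)
qed

text \<open>Far to the right killing is almost certain: the indicator vanishes as soon as s > x - Y,
  and |g| dominates.\<close>

lemma (in prob_space) tail_integral_small:
  fixes g Y :: "'a \<Rightarrow> real" and x :: real
  assumes [measurable]: "random_variable borel Y" and g: "integrable M g" and "e > 0"
  shows "eventually (\<lambda>s. (\<integral>\<omega>. indicator {..x - s} (Y \<omega>) * g \<omega> \<partial>M) < e) at_top"
proof -
  have [measurable]: "g \<in> borel_measurable M" using g by simp
  have "((\<lambda>s. \<integral>\<omega>. indicator {..x - s} (Y \<omega>) * g \<omega> \<partial>M) \<longlongrightarrow> (\<integral>\<omega>. 0 \<partial>M)) at_top"
  proof (rule integral_dominated_convergence_at_top)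
    show "integrable M (\<lambda>\<omega>. \<bar>g \<omega>\<bar>)" using g by simp
    have "eventually (\<lambda>s. indicator {..x - s} (Y \<omega>) * g \<omega> = 0) at_top" for \<omega>
      using eventually_gt_at_top[of "x - Y \<omega>"] by eventually_elim (auto simp: indicator_def)
    then show "AE \<omega> in M. ((\<lambda>s. indicator {..x - s} (Y \<omega>) * g \<omega>) \<longlongrightarrow> 0) at_top"
      by (intro AE_I2 tendsto_eventually)
    show "\<forall>\<^sub>F s in at_top. AE \<omega> in M. norm (indicator {..x - s} (Y \<omega>) * g \<omega>) \<le> \<bar>g \<omega>\<bar>"
      by (auto simp: indicator_def)
  qed measurable
  then show ?thesis
    using \<open>e > 0\<close> by (intro order_tendstoD(2)) auto
qed

text \<open>The pure exponential leaves no slack when the transform equals e^(-a). Subtracting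
  \<kappa> creates slack, since a constant is multiplied on average by nearly 1 rather than by
  \<phi> < 1; this works where e^(-t s) is large compared with \<kappa>. Elsewhere \<open>s\<close>
  lies far to the right, and killing is strong enough to pay for the floor \<delta>
  \<kappa>.\<close>

lemma (in prob_space) green_finite_of_laplace:
  fixes t :: real
  assumes [measurable]: "random_variable borel X" "random_variable borel Y"
    and "a > 0" "t \<ge> 0"
    and laplace: "(\<integral>\<^sup>+\<omega>. ennreal (exp (- t * X \<omega>)) \<partial>M) \<le> ennreal (exp (- a))"
  shows "green M X Y x a s < \<infinity>"
proof -
  define E where "E \<omega> = exp (- t * X \<omega>)" for \<omega>
  have [measurable]: "E \<in> borel_measurable M" unfolding E_def by measurable
  have E_pos: "E \<omega> > 0" for \<omega> by (simp add: E_def)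
  have E_int: "integrable M E"
    using laplace E_pos by (intro integrableI_nonneg) (auto simp: E_def intro: order_le_less_trans)
  define \<phi> where "\<phi> = (\<integral>\<omega>. E \<omega> \<partial>M)"
  have "ennreal \<phi> \<le> ennreal (exp (- a))"
    using laplace nn_integral_eq_integral[OF E_int] E_pos
    unfolding \<phi>_def E_def[symmetric] by (metis AE_I2 less_imp_le)
  then have \<phi>: "\<phi> \<le> exp (- a)" "0 \<le> \<phi>" "\<phi> < 1"
    using \<open>a > 0\<close> E_pos by (auto simp: \<phi>_def less_imp_le intro: order_le_less_trans)
  \<comment> \<open>Positivity of \<open>E\<close> makes these means tend to 1, so a suitable
    \<open>m\<close> brings the mean above any number below 1.\<close>
  have lim: "(\<lambda>n. \<integral>\<omega>. min 1 (real n * E \<omega>) \<partial>M) \<longlonglongrightarrow> (\<integral>\<omega>. 1 \<partial>M)"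
  proof (rule integral_dominated_convergence[where w = "\<lambda>_. 1"])
    have "(\<lambda>n. min 1 (real n * E \<omega>)) \<longlonglongrightarrow> 1" for \<omega>
    proof (rule tendsto_eventually)
      obtain n0 :: nat where "1 / E \<omega> \<le> real n0" using real_arch_simple by blast
      then have "1 \<le> real n0 * E \<omega>" using E_pos[of \<omega>] by (simp add: field_simps)
      then have "1 \<le> real n * E \<omega>" if "n \<ge> n0" for n
        using that E_pos[of \<omega>] by (meson mult_right_mono of_nat_mono less_imp_le order_trans)
      then show "eventually (\<lambda>n. min 1 (real n * E \<omega>) = 1) sequentially"
        unfolding eventually_sequentially by (metis min.absorb1)
    qed
    then show "AE \<omega> in M. (\<lambda>n. min 1 (real n * E \<omega>)) \<longlonglongrightarrow> 1" by simp
    have "0 \<le> real n * E \<omega>" for n \<omega> by (simp add: E_pos less_imp_le)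
    then have "norm (min 1 (real n * E \<omega>)) \<le> 1" for n \<omega> by (simp add: min_def)
    then show "AE \<omega> in M. norm (min 1 (real n * E \<omega>)) \<le> 1" for n by simp
  qed auto
  have ev_m: "eventually (\<lambda>n. (\<integral>\<omega>. min 1 (real n * E \<omega>) \<partial>M) > (1 + \<phi>) / 2) sequentially"
    by (rule order_tendstoD(1)[OF lim]) (use \<phi> in \<open>simp add: prob_space\<close>)
  obtain m :: nat where m: "(\<integral>\<omega>. min 1 (real m * E \<omega>) \<partial>M) > (1 + \<phi>) / 2" "m > 0"
    using eventually_happens'[OF sequentially_bot eventually_conj[OF ev_m eventually_gt_at_top[of 0]]] by blast
  \<comment> \<open>The distance from \<phi> to (1 + \<phi>) / 2 is 2 \<delta>: one \<delta> pays
    for the floor of \<open>V\<close>, the other remains as slack.\<close>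
  define \<delta> where "\<delta> = (1 - \<phi>) / 4"
  have "\<delta> > 0" using \<phi> by (simp add: \<delta>_def)
  have ev_L: "eventually (\<lambda>s. (\<integral>\<omega>. indicator {..x - s} (Y \<omega>) * E \<omega> \<partial>M) < exp (- a) * \<delta> / (4 * m)) at_top"
    using \<open>\<delta> > 0\<close> m(2) by (intro tail_integral_small E_int) auto
  have ev_L': "eventually (\<lambda>s. (\<integral>\<omega>. indicator {..x - s} (Y \<omega>) * 1 \<partial>M) < exp (- a) / 4) at_top"
    by (intro tail_integral_small) auto
  obtain L where L: "\<And>s. s \<ge> L \<Longrightarrow> (\<integral>\<omega>. indicator {..x - s} (Y \<omega>) * E \<omega> \<partial>M) < exp (- a) * \<delta> / (4 * m)"
      "\<And>s. s \<ge> L \<Longrightarrow> (\<integral>\<omega>. indicator {..x - s} (Y \<omega>) * 1 \<partial>M) < exp (- a) / 4"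
    using eventually_conj[OF ev_L ev_L'] unfolding eventually_at_top_linorder by blast
  \<comment> \<open>This makes m \<kappa> equal to e^(-t L), so that e^(-t s) < m \<kappa> forces s
    \<ge> L, where the tail bounds hold.\<close>
  define \<kappa> where "\<kappa> = exp (- t * L) / m"
  have "\<kappa> > 0" using m(2) by (simp add: \<kappa>_def)
  define V where "V s = max (exp (- t * s) - \<kappa>) 0 + \<delta> * \<kappa>" for s
  have V_nonneg: "V s \<ge> 0" for s using \<open>\<delta> > 0\<close> \<open>\<kappa> > 0\<close> by (simp add: V_def)
  have [measurable]: "V \<in> borel_measurable borel" unfolding V_def by measurable
  have V_shift: "V (s + X \<omega>) = exp (- t * s) * E \<omega> - min \<kappa> (exp (- t * s) * E \<omega>) + \<delta> * \<kappa>" for s \<omega>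
    by (simp add: V_def E_def max_def min_def exp_add[symmetric] algebra_simps)
  have min_int: "integrable M (\<lambda>\<omega>. min c (d * E \<omega>))" for c d :: real
    using E_int by (intro integrable_min) auto
  have V_int: "integrable M (\<lambda>\<omega>. V (s + X \<omega>))" for s
    unfolding V_shift using E_int min_int by auto
  define c where "c = min (\<kappa> * \<delta>) (exp (- a) * \<delta> * \<kappa> / 2)"
  have "c > 0" using \<open>\<delta> > 0\<close> \<open>\<kappa> > 0\<close> by (simp add: c_def)
  have key: "c + (\<integral>\<omega>. indicator {..x - s} (Y \<omega>) * V (s + X \<omega>) \<partial>M) \<le> exp (- a) * V s" for s
  proof (cases "exp (- t * s) \<ge> m * \<kappa>")
    case True
    define u where "u = exp (- t * s)"
    \<comment> \<open>In this case killing is ignored; the slack comes from the subtraction of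
      \<kappa> alone.\<close>
    have "(\<integral>\<omega>. indicator {..x - s} (Y \<omega>) * V (s + X \<omega>) \<partial>M) \<le> (\<integral>\<omega>. V (s + X \<omega>) \<partial>M)"
      using V_nonneg by (intro integral_mono_AE' V_int AE_I2) (auto simp: indicator_def)
    also have "\<dots> = u * \<phi> - (\<integral>\<omega>. min \<kappa> (u * E \<omega>) \<partial>M) + \<delta> * \<kappa>"
      unfolding V_shift \<phi>_def u_def using E_int min_int by (simp add: prob_space)
    also have "\<dots> \<le> u * \<phi> - (\<integral>\<omega>. \<kappa> * min 1 (m * E \<omega>) \<partial>M) + \<delta> * \<kappa>"
    proof -
      have "\<kappa> * min 1 (m * E \<omega>) \<le> min \<kappa> (u * E \<omega>)" for \<omega>
        using True \<open>\<kappa> > 0\<close> E_pos[of \<omega>]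
        by (auto simp: min_mult_distrib_left u_def mult_ac intro!: min.coboundedI2 mult_left_mono)
      then show ?thesis
        using min_int by (intro add_right_mono diff_left_mono integral_mono) auto
    qed
    also have "\<dots> \<le> u * \<phi> - \<kappa> * ((1 + \<phi>) / 2) + \<delta> * \<kappa>"
      using m(1) \<open>\<kappa> > 0\<close> by (simp add: less_imp_le)
    also have "\<dots> = \<phi> * (u - \<kappa> + \<delta> * \<kappa>) - \<kappa> * \<delta> - \<phi> * \<delta> * \<kappa>"
      by (simp add: \<delta>_def field_simps)
    also have "\<dots> \<le> \<phi> * V s - \<kappa> * \<delta>"
    proof -
      have "\<phi> * (u - \<kappa> + \<delta> * \<kappa>) \<le> \<phi> * V s"
        using \<phi> by (intro mult_left_mono) (auto simp: V_def u_def)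
      moreover have "0 \<le> \<phi> * \<delta> * \<kappa>"
        using \<phi> \<open>\<delta> > 0\<close> \<open>\<kappa> > 0\<close> by simp
      ultimately show ?thesis by linarith
    qed
    also have "\<dots> \<le> exp (- a) * V s - c"
      using \<phi> V_nonneg[of s] by (intro diff_mono mult_right_mono) (auto simp: c_def)
    finally show ?thesis by linarith
  next
    case False
    define u where "u = exp (- t * s)"
    have u: "0 < u" "u < m * \<kappa>" using False by (auto simp: u_def)
    then have "exp (- t * s) < exp (- t * L)"
      using m(2) by (simp add: u_def \<kappa>_def)
    then have "s \<ge> L"
      using \<open>t \<ge> 0\<close> by (auto simp: mult_less_cancel_left)
    have ind_int: "integrable M (\<lambda>\<omega>. indicator {..x - s} (Y \<omega>) * E \<omega>)"
      by (rule Bochner_Integration.integrable_bound[OF E_int]) (auto simp: indicator_def)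
    have ind_int': "integrable M (\<lambda>\<omega>. indicator {..x - s} (Y \<omega>) * (1::real))"
      by (rule Bochner_Integration.integrable_bound[OF integrable_const[of "1::real"]]) (auto simp: indicator_def)
    have "(\<integral>\<omega>. indicator {..x - s} (Y \<omega>) * V (s + X \<omega>) \<partial>M) \<le>
        (\<integral>\<omega>. u * (indicator {..x - s} (Y \<omega>) * E \<omega>) + \<delta> * \<kappa> * (indicator {..x - s} (Y \<omega>) * 1) \<partial>M)"
    proof (rule integral_mono_AE')
      show "integrable M (\<lambda>\<omega>. u * (indicator {..x - s} (Y \<omega>) * E \<omega>) + \<delta> * \<kappa> * (indicator {..x - s} (Y \<omega>) * 1))"
        by (intro Bochner_Integration.integrable_add integrable_mult_right ind_int ind_int')
      show "AE \<omega> in M. indicator {..x - s} (Y \<omega>) * V (s + X \<omega>) \<le>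
          u * (indicator {..x - s} (Y \<omega>) * E \<omega>) + \<delta> * \<kappa> * (indicator {..x - s} (Y \<omega>) * 1)"
      proof (rule AE_I2)
        fix \<omega>
        have "min \<kappa> (u * E \<omega>) \<ge> 0"
          using \<open>\<kappa> > 0\<close> u E_pos[of \<omega>] by simp
        then show "indicator {..x - s} (Y \<omega>) * V (s + X \<omega>) \<le>
            u * (indicator {..x - s} (Y \<omega>) * E \<omega>) + \<delta> * \<kappa> * (indicator {..x - s} (Y \<omega>) * 1)"
          unfolding V_shift u_def[symmetric] by (simp add: indicator_def)
      qed
      show "AE \<omega> in M. 0 \<le> u * (indicator {..x - s} (Y \<omega>) * E \<omega>) + \<delta> * \<kappa> * (indicator {..x - s} (Y \<omega>) * 1)"
        using \<open>\<kappa> > 0\<close> \<open>\<delta> > 0\<close> u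
        by (intro AE_I2 add_nonneg_nonneg mult_nonneg_nonneg less_imp_le[OF E_pos]) auto
    qed
    also have "\<dots> = u * (\<integral>\<omega>. indicator {..x - s} (Y \<omega>) * E \<omega> \<partial>M) + \<delta> * \<kappa> * (\<integral>\<omega>. indicator {..x - s} (Y \<omega>) * 1 \<partial>M)"
      unfolding integral_mult_right_zero[symmetric]
      by (intro Bochner_Integration.integral_add integrable_mult_right ind_int ind_int')
    \<comment> \<open>By the choice of the tail bounds each summand is a quarter of e^(-a) \<delta>
      \<kappa>, so half of the floor is left for \<open>c\<close>.\<close>
    also have "\<dots> \<le> (m * \<kappa>) * (exp (- a) * \<delta> / (4 * m)) + \<delta> * \<kappa> * (exp (- a) / 4)"
      using L[OF \<open>s \<ge> L\<close>] u \<open>\<delta> > 0\<close> \<open>\<kappa> > 0\<close>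
      by (intro add_mono mult_mono integral_nonneg_AE AE_I2 mult_nonneg_nonneg less_imp_le[OF E_pos])
         (auto simp: less_imp_le)
    also have "\<dots> = exp (- a) * (\<delta> * \<kappa>) - exp (- a) * \<delta> * \<kappa> / 2"
      using m(2) by (simp add: field_simps)
    also have "\<dots> \<le> exp (- a) * V s - c"
      by (intro diff_mono mult_left_mono) (auto simp: V_def c_def)
    finally show ?thesis by linarith
  qed
  show ?thesis
  proof (rule green_finite_of_supersolution[where V = "\<lambda>s. ennreal (V s)" and c = "ennreal (exp a * c)"])
    show "ennreal (exp a * c) + ennreal (exp a) * killed_step M X Y x (\<lambda>s. ennreal (V s)) s \<le> ennreal (V s)" for s
    proof -
      let ?I = "\<integral>\<omega>. indicator {..x - s} (Y \<omega>) * V (s + X \<omega>) \<partial>M"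
      have "killed_step M X Y x (\<lambda>s. ennreal (V s)) s = (\<integral>\<^sup>+\<omega>. ennreal (indicator {..x - s} (Y \<omega>) * V (s + X \<omega>)) \<partial>M)"
        unfolding killed_step_def by (intro nn_integral_cong) (auto simp: indicator_def)
      also have "\<dots> = ennreal ?I"
        using V_nonneg by (intro nn_integral_eq_integral Bochner_Integration.integrable_bound[OF V_int[of s]]) (auto simp: indicator_def)
      finally have "ennreal (exp a * c) + ennreal (exp a) * killed_step M X Y x (\<lambda>s. ennreal (V s)) s = ennreal (exp a * (c + ?I))"
        using V_nonneg \<open>c > 0\<close> by (simp add: ennreal_mult''[symmetric] ennreal_plus[symmetric] algebra_simps del: ennreal_plus)
      also have "\<dots> \<le> ennreal (exp a * (exp (- a) * V s))"
        using key[of s] by (intro ennreal_leI mult_left_mono) auto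
      also have "\<dots> = ennreal (V s)"
        by (simp add: mult.assoc[symmetric] exp_add[symmetric])
      finally show ?thesis .
    qed
  qed (use \<open>c > 0\<close> in auto)
qed

section \<open>Nonnegative steps and truncated steps\<close>

context prob_space
begin

text \<open>A walk at or above 0 almost surely does not step down while it survives, so the
  supersolution may be infinite below 0. On [0, \<infinity>) the function e^(-n s) is multiplied by
  nearly P(X = 0, Y \<le> x) < e^(-a) at most, once n is large. The added constant \<open>e\<close>
  covers the far right, where the slack of the exponential dies out but killing is strong.\<close>

lemma green_finite_of_nonneg_steps:
  assumes [measurable]: "random_variable borel X" "random_variable borel Y"
    and null: "\<P>(\<omega> in M. X \<omega> < 0 \<and> Y \<omega> \<le> x) = 0"
    and q: "exp a * \<P>(\<omega> in M. X \<omega> = 0 \<and> Y \<omega> \<le> x) < 1"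
  shows "green M X Y x a 0 < \<infinity>"
proof -
  define E where "E n \<omega> = indicator {\<omega>. 0 \<le> X \<omega> \<and> Y \<omega> \<le> x} \<omega> * exp (- real n * X \<omega>)" for n \<omega>
  have [measurable]: "E n \<in> borel_measurable M" for n unfolding E_def indicator_def mem_Collect_eq by measurable
  have E_bound: "0 \<le> E n \<omega>" "E n \<omega> \<le> 1" for n \<omega>
    by (auto simp: E_def indicator_def)
  have E_int: "integrable M (E n)" for n
    by (rule Bochner_Integration.integrable_bound[OF integrable_const[of "1::real"]]) (use E_bound in auto)
  have "(\<lambda>n. \<integral>\<omega>. E n \<omega> \<partial>M) \<longlonglongrightarrow> (\<integral>\<omega>. indicator {\<omega>\<in>space M. X \<omega> = 0 \<and> Y \<omega> \<le> x} \<omega> \<partial>M)"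
  proof (rule integral_dominated_convergence[where w = "\<lambda>_. 1"])
    show "AE \<omega> in M. (\<lambda>n. E n \<omega>) \<longlonglongrightarrow> indicator {\<omega>\<in>space M. X \<omega> = 0 \<and> Y \<omega> \<le> x} \<omega>"
    proof (rule AE_I2)
      fix \<omega> assume "\<omega> \<in> space M"
      show "(\<lambda>n. E n \<omega>) \<longlonglongrightarrow> indicator {\<omega>\<in>space M. X \<omega> = 0 \<and> Y \<omega> \<le> x} \<omega>"
      proof (cases "X \<omega> > 0 \<and> Y \<omega> \<le> x")
        case True
        have "E n \<omega> = exp (- X \<omega>) ^ n" for n
          using True by (simp add: E_def exp_of_nat_mult[symmetric])
        then show ?thesis
          using True by (simp add: LIMSEQ_power_zero)
      next
        case False
        then have "E n \<omega> = indicator {\<omega>\<in>space M. X \<omega> = 0 \<and> Y \<omega> \<le> x} \<omega>" for n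
          using \<open>\<omega> \<in> space M\<close> by (auto simp: E_def indicator_def)
        then show ?thesis by simp
      qed
    qed
  qed (use E_bound in auto)
  moreover have "(\<integral>\<omega>. indicator {\<omega>\<in>space M. X \<omega> = 0 \<and> Y \<omega> \<le> x} \<omega> \<partial>M) < exp (- a)"
    using q by (simp add: exp_minus field_simps)
  ultimately have "eventually (\<lambda>n. (\<integral>\<omega>. E n \<omega> \<partial>M) < exp (- a)) sequentially"
    by (rule order_tendstoD(2))
  then obtain n where n: "(\<integral>\<omega>. E n \<omega> \<partial>M) < exp (- a)"
    using eventually_happens'[OF sequentially_bot] by blast
  define l where "l = (\<integral>\<omega>. E n \<omega> \<partial>M)"
  have "0 \<le> l" unfolding l_def using E_bound by simp
  have "eventually (\<lambda>s. (\<integral>\<omega>. indicator {..x - s} (Y \<omega>) * 1 \<partial>M) < exp (- a) / 2) at_top"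
    by (intro tail_integral_small) auto
  then obtain L where L: "\<And>s. s \<ge> L \<Longrightarrow> (\<integral>\<omega>. indicator {..x - s} (Y \<omega>) * 1 \<partial>M) < exp (- a) / 2"
    unfolding eventually_at_top_linorder by blast
  \<comment> \<open>To the left of \<open>L\<close> the slack e^(-n s) (e^(-a) - l) is at least 2 e,
    enough for both the unkilled constant and \<open>c\<close>.\<close>
  define e where "e = exp (- real n * L) * (exp (- a) - l) / 2"
  have "e > 0" using n by (simp add: e_def l_def)
  define c where "c = e * min 1 (exp (- a) / 2)"
  have "c > 0" using \<open>e > 0\<close> by (simp add: c_def)
  define V where "V s = exp (- real n * s) + e" for s
  have key: "c + (exp (- real n * s) * l + e * (\<integral>\<omega>. indicator {..x - s} (Y \<omega>) * 1 \<partial>M)) \<le> exp (- a) * V s" for s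
  proof (cases "s \<ge> L")
    case True
    have "e * (\<integral>\<omega>. indicator {..x - s} (Y \<omega>) * 1 \<partial>M) \<le> e * (exp (- a) / 2)"
      using L[OF True] \<open>e > 0\<close> by (intro mult_left_mono) auto
    moreover have "exp (- real n * s) * l \<le> exp (- real n * s) * exp (- a)"
      using n by (intro mult_left_mono) (auto simp: l_def)
    moreover have "c \<le> e * (exp (- a) / 2)"
      unfolding c_def using \<open>e > 0\<close> by (intro mult_left_mono) auto
    moreover have "exp (- a) * V s = exp (- real n * s) * exp (- a) + e * (exp (- a) / 2) + e * (exp (- a) / 2)"
      by (simp add: V_def distrib_left mult.commute)
    ultimately show ?thesis by linarith
  next
    case False
    have "(\<integral>\<omega>. indicator {..x - s} (Y \<omega>) * 1 \<partial>M) \<le> (\<integral>\<omega>. (1::real) \<partial>M)"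
      by (intro integral_mono_AE') (auto simp: indicator_def)
    then have "e * (\<integral>\<omega>. indicator {..x - s} (Y \<omega>) * 1 \<partial>M) \<le> e"
      using \<open>e > 0\<close> by (simp add: prob_space)
    moreover have "c \<le> e"
      unfolding c_def using \<open>e > 0\<close> by simp
    moreover have "exp (- real n * L) * (exp (- a) - l) \<le> exp (- real n * s) * (exp (- a) - l)"
      using False n by (intro mult_right_mono) (auto simp: l_def intro: mult_left_mono)
    moreover have "2 * e = exp (- real n * L) * (exp (- a) - l)"
      by (simp add: e_def)
    moreover have "exp (- a) * V s = exp (- real n * s) * (exp (- a) - l) + exp (- real n * s) * l + exp (- a) * e"
      by (simp add: V_def algebra_simps)
    moreover have "0 \<le> exp (- a) * e" using \<open>e > 0\<close> by simp
    ultimately show ?thesis by linarith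
  qed
  have AE: "AE \<omega> in M. \<not> (X \<omega> < 0 \<and> Y \<omega> \<le> x)"
    using null by (subst (asm) prob_eq_0) auto
  define W where "W s = (if s < 0 then \<infinity> else ennreal (V s))" for s
  have [measurable]: "W \<in> borel_measurable borel"
    unfolding W_def V_def by measurable
  have ind_int: "integrable M (\<lambda>\<omega>. indicator {..x - s} (Y \<omega>) * (1::real))" for s
    by (rule Bochner_Integration.integrable_bound[OF integrable_const[of "1::real"]]) (auto simp: indicator_def)
  show ?thesis
  proof (rule green_finite_of_supersolution[where V = W and c = "ennreal (exp a * c)"])
    show "ennreal (exp a * c) + ennreal (exp a) * killed_step M X Y x W s \<le> W s" for s
    proof (cases "s < 0")
      case False
      let ?I = "exp (- real n * s) * l + e * (\<integral>\<omega>. indicator {..x - s} (Y \<omega>) * 1 \<partial>M)"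
      have I_nonneg: "0 \<le> ?I"
        using \<open>e > 0\<close> \<open>0 \<le> l\<close> by (auto intro!: add_nonneg_nonneg mult_nonneg_nonneg)
      have "killed_step M X Y x W s \<le>
          (\<integral>\<^sup>+\<omega>. ennreal (exp (- real n * s) * E n \<omega> + e * (indicator {..x - s} (Y \<omega>) * 1)) \<partial>M)"
        unfolding killed_step_def
      proof (rule nn_integral_mono_AE, use AE in eventually_elim)
        fix \<omega> assume "\<not> (X \<omega> < 0 \<and> Y \<omega> \<le> x)"
        show "indicator {..x - s} (Y \<omega>) * W (s + X \<omega>) \<le>
            ennreal (exp (- real n * s) * E n \<omega> + e * (indicator {..x - s} (Y \<omega>) * 1))"
        proof (cases "Y \<omega> \<le> x - s")
          case True
          \<comment> \<open>Survival from s \<ge> 0 gives Y \<le> x - s \<le> x, hence X \<ge> 0 off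
            the null set, and the infinite values of \<open>W\<close> are never met.\<close>
          then have "0 \<le> X \<omega>" "Y \<omega> \<le> x"
            using \<open>\<not> (X \<omega> < 0 \<and> Y \<omega> \<le> x)\<close> False by auto
          then show ?thesis
            using True False by (simp add: W_def V_def E_def exp_add[symmetric] algebra_simps)
        qed simp
      qed
      also have "\<dots> = ennreal ?I"
      proof -
        have "(\<integral>\<omega>. exp (- real n * s) * E n \<omega> + e * (indicator {..x - s} (Y \<omega>) * 1) \<partial>M) = ?I"
          unfolding l_def integral_mult_right_zero[symmetric]
          by (intro Bochner_Integration.integral_add integrable_mult_right ind_int E_int)
        moreover have "(\<integral>\<^sup>+\<omega>. ennreal (exp (- real n * s) * E n \<omega> + e * (indicator {..x - s} (Y \<omega>) * 1)) \<partial>M) =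
          ennreal (\<integral>\<omega>. exp (- real n * s) * E n \<omega> + e * (indicator {..x - s} (Y \<omega>) * 1) \<partial>M)"
          using \<open>e > 0\<close> E_bound
          by (intro nn_integral_eq_integral Bochner_Integration.integrable_add integrable_mult_right ind_int E_int
              AE_I2 add_nonneg_nonneg mult_nonneg_nonneg) auto
        ultimately show ?thesis by simp
      qed
      finally have "ennreal (exp a * c) + ennreal (exp a) * killed_step M X Y x W s \<le>
          ennreal (exp a * c) + ennreal (exp a) * ennreal ?I"
        by (intro add_left_mono mult_left_mono) auto
      also have "\<dots> = ennreal (exp a * (c + ?I))"
      proof -
        have "ennreal (exp a * c) + ennreal (exp a) * ennreal r = ennreal (exp a * (c + r))" if "0 \<le> r" for r
          using that \<open>c > 0\<close>
          by (simp add: ennreal_mult''[symmetric] ennreal_plus[symmetric] algebra_simps del: ennreal_plus)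
        then show ?thesis using I_nonneg .
      qed
      also have "\<dots> \<le> ennreal (exp a * (exp (- a) * V s))"
        using key[of s] by (intro ennreal_leI mult_left_mono) auto
      also have "\<dots> = W s"
        using False by (simp add: W_def mult.assoc[symmetric] exp_add[symmetric])
      finally show ?thesis .
    qed (simp add: W_def)
  qed (use \<open>c > 0\<close> in \<open>auto simp: W_def\<close>)
qed

text \<open>Paths that stay at 0 already make the series diverge: the indicator of {0} is a
  subsolution.\<close>

lemma green_infinite_of_zero_steps:
  assumes [measurable]: "random_variable borel X" "random_variable borel Y"
    and "exp a * \<P>(\<omega> in M. X \<omega> = 0 \<and> Y \<omega> \<le> x) \<ge> 1"
  shows "green M X Y x a 0 = \<infinity>"
proof (rule green_infinite_of_subsolution[where w = "indicator {0}" and l = "ennreal (\<P>(\<omega> in M. X \<omega> = 0 \<and> Y \<omega> \<le> x))"])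
  let ?A = "{\<omega>\<in>space M. X \<omega> = 0 \<and> Y \<omega> \<le> x}"
  show "ennreal (prob ?A) * indicator {0} s \<le> killed_step M X Y x (indicator {0}) s" for s
  proof (cases "s = 0")
    case True
    have "ennreal (prob ?A) = (\<integral>\<^sup>+\<omega>. indicator ?A \<omega> \<partial>M)"
      by (simp add: emeasure_eq_measure)
    also have "\<dots> \<le> killed_step M X Y x (indicator {0}) 0"
      unfolding killed_step_def by (intro nn_integral_mono) (auto simp: indicator_def)
    finally show ?thesis using True by simp
  qed simp
  show "1 \<le> ennreal (exp a) * ennreal (prob ?A)"
    using assms(3) by (simp add: ennreal_mult''[symmetric])
qed (auto simp: indicator_def)

text \<open>Discarding the steps outside the truncation only lowers \<open>K w\<close>, and from s
  \<le> x - B the bound Y \<le> B excludes killing. Hence the mean in \<open>sub\<close> carries the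
  truncation in place of the killing indicator.\<close>

lemma green_infinite_of_truncated_subsolution:
  fixes w :: "real \<Rightarrow> real"
  assumes [measurable]: "random_variable borel X" "random_variable borel Y" "w \<in> borel_measurable borel"
    and w: "\<And>s. 0 \<le> w s" "\<And>s. w s \<le> 1"
    and sub: "\<And>s. w s > 0 \<Longrightarrow> s \<le> x - B \<and>
      l * w s \<le> (\<integral>\<omega>. indicator {\<omega>\<in>space M. \<bar>X \<omega>\<bar> \<le> B \<and> Y \<omega> \<le> B} \<omega> * w (s + X \<omega>) \<partial>M)"
    and l: "0 \<le> l" "1 \<le> exp a * l" and "w s > 0"
  shows "green M X Y x a s = \<infinity>"
proof (rule green_infinite_of_subsolution[where w = "\<lambda>s. ennreal (w s)" and l = "ennreal l"])
  let ?A = "{\<omega>\<in>space M. \<bar>X \<omega>\<bar> \<le> B \<and> Y \<omega> \<le> B}"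
  show "ennreal l * ennreal (w s) \<le> killed_step M X Y x (\<lambda>s. ennreal (w s)) s" for s
  proof (cases "w s > 0")
    case True
    have int: "integrable M (\<lambda>\<omega>. indicator ?A \<omega> * w (s + X \<omega>))"
      by (rule Bochner_Integration.integrable_bound[OF integrable_const[of "1::real"]])
         (use w in \<open>auto simp: indicator_def\<close>)
    have "ennreal l * ennreal (w s) \<le> ennreal (\<integral>\<omega>. indicator ?A \<omega> * w (s + X \<omega>) \<partial>M)"
      using sub[OF True] w(1) l(1) by (simp add: ennreal_mult[symmetric] ennreal_leI)
    also have "\<dots> = (\<integral>\<^sup>+\<omega>. ennreal (indicator ?A \<omega> * w (s + X \<omega>)) \<partial>M)"
      using int w(1) by (intro nn_integral_eq_integral[symmetric]) auto
    also have "\<dots> \<le> killed_step M X Y x (\<lambda>s. ennreal (w s)) s"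
      unfolding killed_step_def using sub[OF True] by (intro nn_integral_mono) (auto simp: indicator_def)
    finally show ?thesis .
  qed (use w(1)[of s] in simp)
  show "1 \<le> ennreal (exp a) * ennreal l"
    using l by (simp add: ennreal_mult''[symmetric])
qed (use w \<open>w s > 0\<close> in auto)

end

section \<open>Tilted sine subsolutions and the truncated Laplace transform\<close>

context prob_space
begin

text \<open>The subsolution is a tilted sine on one half-period, cut off to 0 elsewhere: a step of size at most
  a quarter period leads to points where the sine is nonpositive or the cut-off is inactive, so the
  cut-off only increases the mean. The tilt \<open>t\<close> is chosen such that the odd part
  \<open>S t\<close> vanishes. If \<open>S 0 < 0\<close>, its zero would be negative; then no tilt is used and the sine
  is continued by the constant 1 to the left of its maximum.\<close>

lemma truncated_laplace_less:
  assumes [measurable]: "random_variable borel X" "random_variable borel Y"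
    and fin: "\<And>s. green M X Y x a s < \<infinity>"
    and "v > 0" "B * v \<le> pi / 2" "0 < d" "d \<le> B"
  defines "G \<equiv> {\<omega>\<in>space M. \<bar>X \<omega>\<bar> \<le> B \<and> Y \<omega> \<le> B}"
  assumes p: "\<P>(\<omega> in M. \<omega> \<in> G \<and> X \<omega> \<le> - d) > 0"
  shows "\<exists>t\<ge>0. exp a * (cos (B * v) * (\<integral>\<omega>. indicator G \<omega> * exp (- t * X \<omega>) \<partial>M)) < 1"
proof -
  have [measurable]: "G \<in> events" unfolding G_def by measurable
  have "B > 0" using \<open>0 < d\<close> \<open>d \<le> B\<close> by simp
  have XG: "\<bar>v * X \<omega>\<bar> \<le> B * v" "\<bar>v * X \<omega>\<bar> \<le> pi / 2" if "\<omega> \<in> G" for \<omega>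
  proof -
    show "\<bar>v * X \<omega>\<bar> \<le> B * v"
      using that \<open>v > 0\<close> by (auto simp: G_def abs_mult mult.commute[of v] intro: mult_right_mono)
    then show "\<bar>v * X \<omega>\<bar> \<le> pi / 2"
      using \<open>B * v \<le> pi / 2\<close> by linarith
  qed
  have exp_le: "exp (- t * X \<omega>) \<le> exp (\<bar>t\<bar> * B)" if "\<omega> \<in> G" for t \<omega>
  proof -
    have "- t * X \<omega> \<le> \<bar>t\<bar> * \<bar>X \<omega>\<bar>" by (metis abs_ge_self abs_minus_cancel abs_mult)
    also have "\<dots> \<le> \<bar>t\<bar> * B" using that by (intro mult_left_mono) (auto simp: G_def)
    finally show ?thesis by simp
  qed
  have int: "integrable M (\<lambda>\<omega>. indicator G \<omega> * (exp (- t * X \<omega>) * f (X \<omega>)))"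
    if [measurable]: "f \<in> borel_measurable borel" and f: "\<And>u. \<bar>f u\<bar> \<le> 1" for t and f :: "real \<Rightarrow> real"
  proof (rule Bochner_Integration.integrable_bound[OF integrable_const[of "exp (\<bar>t\<bar> * B)"]])
    have "exp (- t * X \<omega>) * \<bar>f (X \<omega>)\<bar> \<le> exp (\<bar>t\<bar> * B) * 1" if "\<omega> \<in> G" for \<omega>
      using exp_le[OF that] f by (intro mult_mono) auto
    then show "AE \<omega> in M. norm (indicator G \<omega> * (exp (- t * X \<omega>) * f (X \<omega>))) \<le> norm (exp (\<bar>t\<bar> * B))"
      by (intro AE_I2) (auto simp: indicator_def abs_mult)
  qed measurable
  \<comment> \<open>With \<open>S\<close> and \<open>C\<close> below, C t - i S t is the truncated
    transform at the complex argument t + i v, and \<phi> is the transform at the real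
    argument.\<close>
  define \<phi> where "\<phi> t = (\<integral>\<omega>. indicator G \<omega> * exp (- t * X \<omega>) \<partial>M)" for t
  define S where "S t = (\<integral>\<omega>. indicator G \<omega> * (exp (- t * X \<omega>) * sin (v * X \<omega>)) \<partial>M)" for t
  define C where "C t = (\<integral>\<omega>. indicator G \<omega> * (exp (- t * X \<omega>) * cos (v * X \<omega>)) \<partial>M)" for t
  have int_S: "integrable M (\<lambda>\<omega>. indicator G \<omega> * (exp (- t * X \<omega>) * sin (v * X \<omega>)))" for t
    by (intro int[of "\<lambda>u. sin (v * u)"]) auto
  have int_C: "integrable M (\<lambda>\<omega>. indicator G \<omega> * (exp (- t * X \<omega>) * cos (v * X \<omega>)))" for t
    by (intro int[of "\<lambda>u. cos (v * u)"]) auto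
  have int_1: "integrable M (\<lambda>\<omega>. indicator G \<omega> * exp (- t * X \<omega>))" for t
    using int[of "\<lambda>_. 1"] by simp
  have \<phi>_nonneg: "0 \<le> \<phi> t" for t
    unfolding \<phi>_def by simp
  have cos_B: "0 \<le> cos (B * v)"
    using \<open>B > 0\<close> \<open>v > 0\<close> \<open>B * v \<le> pi / 2\<close>
    by (intro cos_ge_zero) (auto intro: order_trans[of _ 0] mult_nonneg_nonneg less_imp_le)
  have cos_le: "cos (B * v) \<le> cos (v * X \<omega>)" if "\<omega> \<in> G" for \<omega>
  proof -
    have "cos (B * v) \<le> cos \<bar>v * X \<omega>\<bar>"
      using XG[OF that] \<open>B * v \<le> pi / 2\<close> pi_gt_zero by (intro cos_monotone_0_pi_le) linarith+
    then show ?thesis by simp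
  qed
  \<comment> \<open>On \<open>G\<close> the angle v X stays within B v, where the cosine is at least
    cos (B v). This factor is the whole cost of passing from \<open>C\<close> to \<phi>, and it is
    close to 1 for small B v.\<close>
  have C_ge: "cos (B * v) * \<phi> t \<le> C t" for t
  proof -
    have "cos (B * v) * \<phi> t = (\<integral>\<omega>. cos (B * v) * (indicator G \<omega> * exp (- t * X \<omega>)) \<partial>M)"
      unfolding \<phi>_def by simp
    also have "\<dots> \<le> C t"
      unfolding C_def
    proof (rule integral_mono[OF integrable_mult_right[OF int_1] int_C])
      fix \<omega> show "cos (B * v) * (indicator G \<omega> * exp (- t * X \<omega>)) \<le> indicator G \<omega> * (exp (- t * X \<omega>) * cos (v * X \<omega>))"
        using cos_le[of \<omega>] by (auto simp: indicator_def mult.commute)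
    qed
    finally show ?thesis .
  qed
  \<comment> \<open>By the subtraction formula, S t = 0 makes the tilted sine an eigenfunction of
    the truncated step without killing, with eigenvalue C t.\<close>
  have combine: "(\<integral>\<omega>. indicator G \<omega> * (exp (- t * X \<omega>) * sin (g - v * X \<omega>)) \<partial>M) = sin g * C t - cos g * S t" for g t
  proof -
    have "(\<integral>\<omega>. indicator G \<omega> * (exp (- t * X \<omega>) * sin (g - v * X \<omega>)) \<partial>M) =
      (\<integral>\<omega>. sin g * (indicator G \<omega> * (exp (- t * X \<omega>) * cos (v * X \<omega>)))
          - cos g * (indicator G \<omega> * (exp (- t * X \<omega>) * sin (v * X \<omega>))) \<partial>M)"
      by (intro Bochner_Integration.integral_cong) (auto simp: sin_diff algebra_simps)
    also have "\<dots> = sin g * C t - cos g * S t"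
      unfolding C_def S_def integral_mult_right_zero[symmetric]
      by (intro Bochner_Integration.integral_diff integrable_mult_right int_C int_S)
    finally show ?thesis .
  qed
  \<comment> \<open>The phase grows to the left and vanishes at x - B, so at nonnegative phase no
    truncated step is killed.\<close>
  define g where "g s = v * (x - B - s)" for s
  have g_shift: "g (s + u) = g s - v * u" for s u
    by (simp add: g_def algebra_simps)
  have [measurable]: "g \<in> borel_measurable borel" unfolding g_def by measurable
  have contra: "exp a * (cos (B * v) * \<phi> t) < 1"
    if [measurable]: "w \<in> borel_measurable borel" and w: "\<And>s. 0 \<le> w s" "\<And>s. w s \<le> 1" "w s0 > 0"
      and sub: "\<And>s. w s > 0 \<Longrightarrow> s \<le> x - B \<and> cos (B * v) * \<phi> t * w s \<le> (\<integral>\<omega>. indicator G \<omega> * w (s + X \<omega>) \<partial>M)"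
    for w s0 t
  proof (rule ccontr)
    assume "\<not> exp a * (cos (B * v) * \<phi> t) < 1"
    then have "green M X Y x a s0 = \<infinity>"
      using cos_B \<phi>_nonneg w sub unfolding G_def
      by (intro green_infinite_of_truncated_subsolution[where w = w and B = B and l = "cos (B * v) * \<phi> t"]) auto
    then show False using fin[of s0] by simp
  qed
  show ?thesis
  proof (cases "S 0 \<ge> 0")
    case True
    define D where "D = {\<omega>\<in>space M. \<omega> \<in> G \<and> X \<omega> \<le> - d}"
    have [measurable]: "D \<in> events" unfolding D_def by measurable
    have "v * d \<le> B * v"
      using \<open>v > 0\<close> mult_left_mono[OF \<open>d \<le> B\<close>, of v] by (simp add: mult.commute)
    then have vd: "0 < v * d" "v * d \<le> pi / 2"
      using mult_pos_pos[OF \<open>v > 0\<close> \<open>0 < d\<close>] \<open>B * v \<le> pi / 2\<close> by linarith+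
    have sin_d: "sin (v * d) > 0"
      using vd pi_gt_zero by (intro sin_gt_zero) linarith+
    \<comment> \<open>Steps down by at least \<open>d\<close> contribute an amount that tends to
      -\<infinity> as t grows, all others at most 1; so \<open>S\<close> is eventually
      nonpositive.\<close>
    have S_le: "S t \<le> 1 - prob D * (exp (t * d) * sin (v * d))" if "t \<ge> 0" for t
    proof -
      have int_D: "integrable M (\<lambda>\<omega>. indicator D \<omega> * (exp (t * d) * sin (v * d)))"
        by (intro integrable_mult_left integrable_real_indicator) (auto simp: emeasure_eq_measure)
      have "S t \<le> (\<integral>\<omega>. 1 - indicator D \<omega> * (exp (t * d) * sin (v * d)) \<partial>M)"
        unfolding S_def
      proof (rule integral_mono[OF int_S])
        fix \<omega>
        show "indicator G \<omega> * (exp (- t * X \<omega>) * sin (v * X \<omega>)) \<le> 1 - indicator D \<omega> * (exp (t * d) * sin (v * d))"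
        proof (cases "\<omega> \<in> G")
          case True
          note XG = XG[OF True]
          show ?thesis
          proof (cases "X \<omega> \<le> - d")
            case X: True
            then have "v * d \<le> v * (- X \<omega>)"
              using \<open>v > 0\<close> by (intro mult_left_mono) auto
            then have "sin (v * d) \<le> sin (v * (- X \<omega>))"
              using XG vd by (intro sin_monotone_2pi_le) auto
            moreover have "exp (t * d) \<le> exp (- t * X \<omega>)"
              using X \<open>t \<ge> 0\<close> mult_left_mono[of d "- X \<omega>" t] by simp
            ultimately have "exp (t * d) * sin (v * d) \<le> exp (- t * X \<omega>) * sin (v * (- X \<omega>))"
              using sin_d by (intro mult_mono) auto
            moreover have "\<omega> \<in> D"
              using True X by (simp add: D_def G_def)
            ultimately show ?thesis
              using True by simp
          next
            case X: False
            have "exp (- t * X \<omega>) * sin (v * X \<omega>) \<le> 1"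
            proof (cases "X \<omega> \<ge> 0")
              case True
              then have "0 \<le> v * X \<omega>" using \<open>v > 0\<close> by simp
              then have "0 \<le> sin (v * X \<omega>)"
                using XG pi_gt_zero by (intro sin_ge_zero) linarith+
              then have "exp (- t * X \<omega>) * sin (v * X \<omega>) \<le> 1 * 1"
                using \<open>t \<ge> 0\<close> True by (intro mult_mono) auto
              then show ?thesis by simp
            next
              case False
              then have "v * X \<omega> \<le> 0" using \<open>v > 0\<close> by (simp add: mult_nonneg_nonpos)
              then have "0 \<le> sin (- (v * X \<omega>))"
                using XG pi_gt_zero by (intro sin_ge_zero) linarith+
              then have "exp (- t * X \<omega>) * sin (v * X \<omega>) \<le> 0"
                by (simp add: mult_nonneg_nonpos)
              then show ?thesis by simp
            qed
            then show ?thesis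
              using X by (auto simp: indicator_def D_def)
          qed
        qed (simp add: D_def)
      qed (intro Bochner_Integration.integrable_diff integrable_const int_D)
      also have "\<dots> = 1 - prob D * (exp (t * d) * sin (v * d))"
        by (subst Bochner_Integration.integral_diff[OF integrable_const int_D]) (simp add: prob_space)
      finally show ?thesis .
    qed
    have "prob D > 0" using p by (simp add: D_def)
    \<comment> \<open>Chosen such that e^(T d) \<ge> 1 + T d exceeds 1 / (prob D sin (v d)), which
      gives S T \<le> 0.\<close>
    define T where "T = 1 / (d * (prob D * sin (v * d)))"
    have "T \<ge> 0"
      using \<open>0 < d\<close> sin_d by (simp add: T_def)
    have "1 / (prob D * sin (v * d)) = T * d"
      using \<open>0 < d\<close> by (simp add: T_def)
    then have "1 / (prob D * sin (v * d)) \<le> exp (T * d)"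
      using exp_ge_add_one_self[of "T * d"] by linarith
    then have "1 \<le> prob D * (exp (T * d) * sin (v * d))"
      using sin_d \<open>prob D > 0\<close> by (simp add: field_simps)
    then have "S T \<le> 0"
      using S_le[OF \<open>T \<ge> 0\<close>] by linarith
    moreover have "continuous_on {0..T} S"
      unfolding continuous_on_sequentially
    proof (intro allI ballI impI, elim conjE)
      fix u :: "nat \<Rightarrow> real" and r
      assume u: "\<forall>n. u n \<in> {0..T}" "u \<longlonglongrightarrow> r"
      show "(S \<circ> u) \<longlonglongrightarrow> S r"
        unfolding comp_def S_def
      proof (rule integral_dominated_convergence[where w = "\<lambda>_. exp (T * B)"])
        show "AE \<omega> in M. (\<lambda>n. indicator G \<omega> * (exp (- u n * X \<omega>) * sin (v * X \<omega>)))
            \<longlonglongrightarrow> indicator G \<omega> * (exp (- r * X \<omega>) * sin (v * X \<omega>))"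
          using u(2) by (intro AE_I2 tendsto_intros)
        have "exp (- u n * X \<omega>) * \<bar>sin (v * X \<omega>)\<bar> \<le> exp (T * B)" if "\<omega> \<in> G" for n \<omega>
        proof -
          have "\<bar>u n\<bar> * B \<le> T * B"
            using u(1) \<open>B > 0\<close> by (intro mult_right_mono) auto
          then have "exp (- u n * X \<omega>) \<le> exp (T * B)"
            using exp_le[OF that, of "u n"] by (meson exp_le_cancel_iff order_trans)
          then have "exp (- u n * X \<omega>) * \<bar>sin (v * X \<omega>)\<bar> \<le> exp (T * B) * 1"
            by (intro mult_mono) auto
          then show ?thesis by simp
        qed
        then show "AE \<omega> in M. norm (indicator G \<omega> * (exp (- u n * X \<omega>) * sin (v * X \<omega>))) \<le> exp (T * B)" for n
          by (intro AE_I2) (auto simp: indicator_def abs_mult)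
      qed auto
    qed
    ultimately obtain t where t: "t \<ge> 0" "S t = 0"
      using IVT2'[of S T 0 0] True \<open>T \<ge> 0\<close> by auto
    \<comment> \<open>The shift by pi / v puts the origin of the exponent at the left end of the
      half-period, so that a tilt t \<ge> 0 keeps \<open>w\<close> at most 1.\<close>
    define w where "w s = (if 0 \<le> g s \<and> g s \<le> pi then exp (- t * (s - (x - B) + pi / v)) * sin (g s) else 0)" for s
    have [measurable]: "w \<in> borel_measurable borel" unfolding w_def by measurable
    have "exp a * (cos (B * v) * \<phi> t) < 1"
    proof (rule contra[of w "x - B - pi / (2 * v)" t])
      show w_nonneg: "0 \<le> w s" for s by (auto simp: w_def sin_ge_zero)
      show "w s \<le> 1" for s
      proof (cases "0 \<le> g s \<and> g s \<le> pi")
        case True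
        then have "0 \<le> s - (x - B) + pi / v"
          using \<open>v > 0\<close> by (simp add: g_def field_simps)
        then have "exp (- t * (s - (x - B) + pi / v)) * sin (g s) \<le> 1 * 1"
          using t(1) True by (intro mult_mono) (auto simp: sin_ge_zero)
        then show ?thesis using True by (simp add: w_def)
      qed (auto simp: w_def)
      have g_mid: "g (x - B - pi / (2 * v)) = pi / 2"
        using \<open>v > 0\<close> by (simp add: g_def)
      show "w (x - B - pi / (2 * v)) > 0"
        unfolding w_def g_mid by simp
      show "s \<le> x - B \<and> cos (B * v) * \<phi> t * w s \<le> (\<integral>\<omega>. indicator G \<omega> * w (s + X \<omega>) \<partial>M)" if "w s > 0" for s
      proof
        have gs: "0 \<le> g s" "g s \<le> pi"
          using that by (auto simp: w_def split: if_splits)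
        then show "s \<le> x - B"
          using \<open>v > 0\<close> by (auto simp: g_def zero_le_mult_iff)
        let ?k = "exp (- t * (s - (x - B) + pi / v))"
        have "cos (B * v) * \<phi> t * w s \<le> C t * (?k * sin (g s))"
          using gs mult_right_mono[OF C_ge[of t] w_nonneg[of s]] by (simp add: w_def)
        also have "\<dots> = ?k * (sin (g s) * C t - cos (g s) * S t)"
          by (simp add: t(2))
        also have "\<dots> = (\<integral>\<omega>. ?k * (indicator G \<omega> * (exp (- t * X \<omega>) * sin (g s - v * X \<omega>))) \<partial>M)"
          by (simp only: combine[symmetric] integral_mult_right_zero)
        also have "\<dots> \<le> (\<integral>\<omega>. indicator G \<omega> * w (s + X \<omega>) \<partial>M)"
        proof (rule integral_mono_AE)
          show "integrable M (\<lambda>\<omega>. ?k * (indicator G \<omega> * (exp (- t * X \<omega>) * sin (g s - v * X \<omega>))))"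
            by (intro integrable_mult_right int[of "\<lambda>u. sin (g s - v * u)"]) auto
          show "integrable M (\<lambda>\<omega>. indicator G \<omega> * w (s + X \<omega>))"
            by (rule Bochner_Integration.integrable_bound[OF integrable_const[of "1::real"]])
               (use w_nonneg \<open>\<And>s. w s \<le> 1\<close> in \<open>auto simp: indicator_def\<close>)
          have "?k * (exp (- t * X \<omega>) * sin (g s - v * X \<omega>)) \<le> w (s + X \<omega>)" if "\<omega> \<in> G" for \<omega>
          proof -
            have eq: "?k * exp (- t * X \<omega>) = exp (- t * (s + X \<omega> - (x - B) + pi / v))"
              by (simp add: exp_add[symmetric] algebra_simps)
            show ?thesis
            proof (cases "0 \<le> g s - v * X \<omega> \<and> g s - v * X \<omega> \<le> pi")
              case True
              then show ?thesis
                unfolding w_def g_shift if_P[OF True] eq[symmetric] by (simp only: mult.assoc order_refl)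
            next
              case False
              \<comment> \<open>A step moves the phase by at most pi / 2, so past either end of the
                half-period it lands where the sine is nonpositive.\<close>
              have "sin (g s - v * X \<omega>) \<le> 0"
              proof (cases "g s - v * X \<omega> < 0")
                case True
                then have "0 \<le> sin (- (g s - v * X \<omega>))"
                  using gs XG[OF \<open>\<omega> \<in> G\<close>] pi_gt_zero by (intro sin_ge_zero) linarith+
                then show ?thesis by (simp only: sin_minus neg_0_le_iff_le)
              next
                case False
                with \<open>\<not> (0 \<le> g s - v * X \<omega> \<and> g s - v * X \<omega> \<le> pi)\<close> have "pi < g s - v * X \<omega>" by auto
                then have "0 \<le> sin (g s - v * X \<omega> - pi)"
                  using gs XG[OF \<open>\<omega> \<in> G\<close>] pi_gt_zero by (intro sin_ge_zero) linarith+
                then show ?thesis by (simp only: sin_minus_pi neg_0_le_iff_le)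
              qed
              then have "?k * (exp (- t * X \<omega>) * sin (g s - v * X \<omega>)) \<le> 0"
                by (simp add: mult_nonneg_nonpos)
              then show ?thesis using w_nonneg[of "s + X \<omega>"] by linarith
            qed
          qed
          then show "AE \<omega> in M. ?k * (indicator G \<omega> * (exp (- t * X \<omega>) * sin (g s - v * X \<omega>))) \<le> indicator G \<omega> * w (s + X \<omega>)"
            by (intro AE_I2) (simp add: indicator_def)
        qed
        finally show "cos (B * v) * \<phi> t * w s \<le> (\<integral>\<omega>. indicator G \<omega> * w (s + X \<omega>) \<partial>M)" .
      qed
    qed measurable
    then show ?thesis using t(1) by (auto simp: \<phi>_def)
  next
    case False
    define w where "w s = (if g s < 0 then 0 else if g s \<le> pi / 2 then sin (g s) else 1)" for s
    have [measurable]: "w \<in> borel_measurable borel" unfolding w_def by measurable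
    have "exp a * (cos (B * v) * \<phi> 0) < 1"
    proof (rule contra[of w "x - B - pi / (2 * v)" 0])
      show w_nonneg: "0 \<le> w s" for s by (auto simp: w_def intro!: sin_ge_zero)
      show "w s \<le> 1" for s by (auto simp: w_def)
      have g_mid: "g (x - B - pi / (2 * v)) = pi / 2"
        using \<open>v > 0\<close> by (simp add: g_def)
      show "w (x - B - pi / (2 * v)) > 0"
        unfolding w_def g_mid by simp
      show "s \<le> x - B \<and> cos (B * v) * \<phi> 0 * w s \<le> (\<integral>\<omega>. indicator G \<omega> * w (s + X \<omega>) \<partial>M)" if "w s > 0" for s
      proof
        have gs: "0 \<le> g s"
          using that by (auto simp: w_def split: if_splits)
        then show "s \<le> x - B"
          using \<open>v > 0\<close> by (auto simp: g_def zero_le_mult_iff)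
        \<comment> \<open>Clipping the phase at pi / 2 gives w s = sin h on both branches and cos h
          \<ge> 0, so that S 0 < 0 only increases the mean.\<close>
        define h where "h = min (g s) (pi / 2)"
        have h: "0 \<le> h" "h \<le> pi / 2" "h \<le> g s" "w s = sin h"
          using gs by (auto simp: h_def w_def min_def)
        have "cos (B * v) * \<phi> 0 * w s \<le> C 0 * sin h"
          using mult_right_mono[OF C_ge[of 0] w_nonneg[of s]] by (simp only: h(4))
        also have "\<dots> \<le> sin h * C 0 - cos h * S 0"
          using False h by (simp add: mult_nonneg_nonpos cos_ge_zero)
        also have "\<dots> = (\<integral>\<omega>. indicator G \<omega> * (exp (- 0 * X \<omega>) * sin (h - v * X \<omega>)) \<partial>M)"
          by (rule combine[symmetric])
        also have "\<dots> \<le> (\<integral>\<omega>. indicator G \<omega> * w (s + X \<omega>) \<partial>M)"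
        proof (rule integral_mono_AE)
          show "integrable M (\<lambda>\<omega>. indicator G \<omega> * (exp (- 0 * X \<omega>) * sin (h - v * X \<omega>)))"
            by (intro int[of "\<lambda>u. sin (h - v * u)"]) auto
          show "integrable M (\<lambda>\<omega>. indicator G \<omega> * w (s + X \<omega>))"
            by (rule Bochner_Integration.integrable_bound[OF integrable_const[of "1::real"]])
               (use w_nonneg \<open>\<And>s. w s \<le> 1\<close> in \<open>auto simp: indicator_def\<close>)
          have "sin (h - v * X \<omega>) \<le> w (s + X \<omega>)" if "\<omega> \<in> G" for \<omega>
          proof -
            consider "g s - v * X \<omega> < 0" | "0 \<le> g s - v * X \<omega>" "g s - v * X \<omega> \<le> pi / 2" | "pi / 2 < g s - v * X \<omega>"
              by linarith
            then show ?thesis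
            proof cases
              case 1
              then have "0 \<le> sin (- (h - v * X \<omega>))"
                using h XG[OF that] pi_gt_zero by (intro sin_ge_zero) linarith+
              then have "sin (h - v * X \<omega>) \<le> 0" by (simp only: sin_minus neg_0_le_iff_le)
              then show ?thesis
                using w_nonneg[of "s + X \<omega>"] by linarith
            next
              case 2
              \<comment> \<open>Both angles lie in [-pi/2, pi/2], where the sine increases, and the
                clipped phase is the smaller one.\<close>
              then have "sin (h - v * X \<omega>) \<le> sin (g s - v * X \<omega>)"
                using h XG[OF that] by (intro sin_monotone_2pi_le) linarith+
              then show ?thesis using 2 by (simp add: w_def g_shift)
            next
              case 3
              then have "\<not> g s - v * X \<omega> < 0" using pi_gt_zero by linarith
              with 3 have "w (s + X \<omega>) = 1"
                unfolding w_def g_shift by simp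
              then show ?thesis by simp
            qed
          qed
          then show "AE \<omega> in M. indicator G \<omega> * (exp (- 0 * X \<omega>) * sin (h - v * X \<omega>)) \<le> indicator G \<omega> * w (s + X \<omega>)"
            by (intro AE_I2) (simp add: indicator_def)
        qed
        finally show "cos (B * v) * \<phi> 0 * w s \<le> (\<integral>\<omega>. indicator G \<omega> * w (s + X \<omega>) \<partial>M)" .
      qed
    qed measurable
    then show ?thesis by (auto simp: \<phi>_def)
  qed
qed

end

section \<open>Equivalence with the Laplace transform condition\<close>

text \<open>The truncation level B tends to infinity with frequency v = 1 / B^2, so B v = 1 / B
  tends to 0 and the cosine factor to 1. The exponents found for the truncated laws then have a
  limit by the Fatou argument.\<close>

lemma (in prob_space) laplace_le_of_green_finite:
  assumes [measurable]: "random_variable borel X" "random_variable borel Y"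
    and p: "\<P>(\<omega> in M. X \<omega> < 0 \<and> Y \<omega> \<le> x) > 0"
    and fin: "green M X Y x a 0 < \<infinity>"
  shows "\<exists>t\<ge>0. (\<integral>\<^sup>+\<omega>. ennreal (exp (- t * X \<omega>)) \<partial>M) \<le> ennreal (exp (- a))"
proof -
  \<comment> \<open>One of these events has positive probability. It fixes the size \<open>d\<close>
    of a descent, and its lower bound on \<open>X\<close> puts it inside every truncation.\<close>
  define D where "D k = {\<omega>\<in>space M. X \<omega> \<le> - 1 / real (Suc k) \<and> - real (Suc k) \<le> X \<omega> \<and> Y \<omega> \<le> x}" for k
  have [measurable]: "D k \<in> events" for k unfolding D_def by measurable
  have "\<exists>k. prob (D k) > 0"
  proof (rule ccontr)
    assume "\<nexists>k. prob (D k) > 0"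
    then have "prob (D k) = 0" for k
      using measure_nonneg[of M "D k"] by (metis less_eq_real_def)
    then have "emeasure M (\<Union>k. D k) = 0"
      by (intro emeasure_UN_eq_0) (auto simp: emeasure_eq_measure)
    moreover have "{\<omega>\<in>space M. X \<omega> < 0 \<and> Y \<omega> \<le> x} \<subseteq> (\<Union>k. D k)"
    proof
      fix \<omega> assume \<omega>: "\<omega> \<in> {\<omega>\<in>space M. X \<omega> < 0 \<and> Y \<omega> \<le> x}"
      obtain k :: nat where k: "max (- X \<omega>) (1 / (- X \<omega>)) \<le> real k"
        using real_arch_simple by blast
      then have "1 / (- X \<omega>) \<le> real (Suc k)" by simp
      then have "X \<omega> \<le> - 1 / real (Suc k)"
        using \<omega> by (simp add: field_simps)
      then show "\<omega> \<in> (\<Union>k. D k)"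
        using k \<omega> by (auto simp: D_def)
    qed
    ultimately have "emeasure M {\<omega>\<in>space M. X \<omega> < 0 \<and> Y \<omega> \<le> x} = 0"
      by (metis (lifting) emeasure_mono sets.countable_UN' le_zero_eq \<open>\<And>k. D k \<in> events\<close> countableI_type range_subsetD image_subset_iff)
    with p show False by (simp add: emeasure_eq_measure)
  qed
  then obtain k where k: "prob (D k) > 0" by blast
  define d where "d = 1 / real (Suc k)"
  have d: "0 < d" "d \<le> 1" by (auto simp: d_def)
  have "prob (D k) \<le> \<P>(\<omega> in M. X \<omega> \<le> - d \<and> Y \<omega> \<le> x)"
    by (intro finite_measure_mono) (auto simp: D_def d_def)
  with k have "\<P>(\<omega> in M. X \<omega> \<le> - d \<and> Y \<omega> \<le> x) > 0" by linarith
  then have fin': "green M X Y x a s < \<infinity>" for s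
    by (rule green_finite_left[OF assms(1,2) d(1) _ fin])
  \<comment> \<open>The summands \<open>Suc k\<close> and |x| put \<open>D k\<close> inside every
    \<open>A n\<close>, and together with the final 1 they give B n \<ge> 2.\<close>
  define B where "B n = real n + real (Suc k) + \<bar>x\<bar> + 1" for n
  have B: "2 \<le> B n" for n by (simp add: B_def)
  define A where "A n = {\<omega>\<in>space M. \<bar>X \<omega>\<bar> \<le> B n \<and> Y \<omega> \<le> B n}" for n
  have [measurable]: "A n \<in> events" for n unfolding A_def by measurable
  have inverse_B: "0 < 1 / B n" "1 / B n \<le> 1 / 2" for n
    using B[of n] by (auto simp: field_simps)
  have cos_pos: "0 < cos (1 / B n)" for n
    using inverse_B[of n] pi_ge_two by (intro cos_gt_zero) linarith+
  have "\<exists>t\<ge>0. exp a * (cos (1 / B n) * (\<integral>\<omega>. indicator (A n) \<omega> * exp (- t * X \<omega>) \<partial>M)) < 1" for n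
  proof -
    have "B n > 0" using B[of n] by simp
    then have eq: "B n * (1 / (B n * B n)) = 1 / B n" by simp
    have "\<omega> \<in> A n \<and> X \<omega> \<le> - d" if "\<omega> \<in> D k" for \<omega>
    proof -
      have "X \<omega> \<le> - d" "- real (Suc k) \<le> X \<omega>" "Y \<omega> \<le> x" "\<omega> \<in> space M"
        using that by (auto simp: D_def d_def)
      with d(1) show ?thesis by (auto simp: A_def B_def)
    qed
    then have "prob (D k) \<le> \<P>(\<omega> in M. \<omega> \<in> A n \<and> X \<omega> \<le> - d)"
      by (intro finite_measure_mono) (auto simp: D_def)
    then have pA: "\<P>(\<omega> in M. \<omega> \<in> A n \<and> X \<omega> \<le> - d) > 0" using k by linarith
    have "B n * (1 / (B n * B n)) \<le> pi / 2"
      unfolding eq using inverse_B[of n] pi_ge_two by linarith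
    from truncated_laplace_less[OF assms(1,2) fin' _ this d(1) _ pA[unfolded A_def]]
    show ?thesis
      unfolding A_def eq using \<open>B n > 0\<close> d(2) B[of n] by simp
  qed
  then obtain t where t: "\<And>n. t n \<ge> 0"
    "\<And>n. exp a * (cos (1 / B n) * (\<integral>\<omega>. indicator (A n) \<omega> * exp (- t n * X \<omega>) \<partial>M)) < 1"
    by metis
  show ?thesis
  proof (rule laplace_limit[where A = A and t = t and c = "\<lambda>n. ennreal (exp (- a) / cos (1 / B n))"])
    have "\<P>(\<omega> in M. X \<omega> < 0 \<and> Y \<omega> \<le> x) \<le> \<P>(\<omega> in M. X \<omega> < 0)"
      by (intro finite_measure_mono) auto
    then show "\<P>(\<omega> in M. X \<omega> < 0) > 0" using p by linarith
    show "eventually (\<lambda>n. \<omega> \<in> A n) sequentially" if "\<omega> \<in> space M" for \<omega>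
    proof -
      obtain n0 :: nat where n0: "max \<bar>X \<omega>\<bar> (Y \<omega>) \<le> real n0"
        using real_arch_simple by blast
      then have "\<omega> \<in> A n" if "n \<ge> n0" for n
        using that \<open>\<omega> \<in> space M\<close> by (auto simp: A_def B_def)
      then show ?thesis by (auto simp: eventually_sequentially)
    qed
    show "(\<integral>\<^sup>+\<omega>. indicator (A n) \<omega> * ennreal (exp (- t n * X \<omega>)) \<partial>M) \<le> ennreal (exp (- a) / cos (1 / B n))" for n
    proof -
      have "exp (- t n * X \<omega>) \<le> exp (t n * B n)" if "\<omega> \<in> A n" for \<omega>
        using mult_left_mono[of "- X \<omega>" "B n" "t n"] that t(1)[of n] by (auto simp: A_def)
      then have "integrable M (\<lambda>\<omega>. indicator (A n) \<omega> * exp (- t n * X \<omega>))"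
        by (intro Bochner_Integration.integrable_bound[OF integrable_const[of "exp (t n * B n)"]])
           (auto simp: indicator_def)
      then have "(\<integral>\<^sup>+\<omega>. ennreal (indicator (A n) \<omega> * exp (- t n * X \<omega>)) \<partial>M) =
          ennreal (\<integral>\<omega>. indicator (A n) \<omega> * exp (- t n * X \<omega>) \<partial>M)"
        by (intro nn_integral_eq_integral) auto
      moreover have "(\<integral>\<omega>. indicator (A n) \<omega> * exp (- t n * X \<omega>) \<partial>M) \<le> exp (- a) / cos (1 / B n)"
        using t(2)[of n] cos_pos[of n] by (simp add: exp_minus field_simps)
      moreover have "(\<integral>\<^sup>+\<omega>. indicator (A n) \<omega> * ennreal (exp (- t n * X \<omega>)) \<partial>M) =
          (\<integral>\<^sup>+\<omega>. ennreal (indicator (A n) \<omega> * exp (- t n * X \<omega>)) \<partial>M)"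
        by (intro nn_integral_cong) (simp add: indicator_def)
      ultimately show ?thesis by (simp add: ennreal_leI)
    qed
    have "filterlim B at_top sequentially"
      unfolding B_def by real_asymp
    then have "(\<lambda>n. 1 / B n) \<longlonglongrightarrow> 0"
      by (intro tendsto_divide_0[OF tendsto_const] filterlim_at_top_imp_at_infinity)
    then have "(\<lambda>n. exp (- a) / cos (1 / B n)) \<longlonglongrightarrow> exp (- a) / cos 0"
      by (intro tendsto_intros) auto
    then show "(\<lambda>n. ennreal (exp (- a) / cos (1 / B n))) \<longlonglongrightarrow> ennreal (exp (- a))"
      by (intro tendsto_ennrealI) simp
  qed (use t(1) in auto)
qed

text \<open>The condition obtained involves neither \<eta> nor \<open>x\<close>; this is what makes
  different levels and the ladder epoch comparable.\<close>

lemma (in perturbed_random_walk) exp_moment_finite_iff_laplace: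
  assumes "a > 0" and p: "\<P>(\<omega> in M. \<xi> 0 \<omega> < 0 \<and> \<eta> 0 \<omega> \<le> x) > 0"
  shows "exp_moment M a (first_passage \<xi> \<eta> x) < \<infinity> \<longleftrightarrow>
         (\<exists>t\<ge>0. (\<integral>\<^sup>+\<omega>. ennreal (exp (- t * \<xi> 0 \<omega>)) \<partial>M) \<le> ennreal (exp (- a)))"
  using laplace_le_of_green_finite[OF xi_measurable eta_measurable p]
    green_finite_of_laplace[OF xi_measurable eta_measurable \<open>a > 0\<close>]
  unfolding exp_moment_first_passage_finite_iff[OF \<open>a > 0\<close>] by blast

theorem theorem2p5:
  fixes M :: "'a measure" and \<xi> \<eta> :: "nat \<Rightarrow> 'a \<Rightarrow> real" and a x :: real
  assumes "perturbed_random_walk M \<xi> \<eta>"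
    and "a > 0"
  shows "(\<P>(\<omega> in M. \<xi> 0 \<omega> < 0 \<and> \<eta> 0 \<omega> \<le> x) = 0 \<longrightarrow>
           (exp_moment M a (first_passage \<xi> \<eta> x) < \<infinity> \<longleftrightarrow>
            exp a * \<P>(\<omega> in M. \<xi> 0 \<omega> = 0 \<and> \<eta> 0 \<omega> \<le> x) < 1))
       \<and> (\<P>(\<omega> in M. \<xi> 0 \<omega> < 0 \<and> \<eta> 0 \<omega> \<le> x) > 0 \<longrightarrow>
           (exp_moment M a (first_passage \<xi> \<eta> x) < \<infinity> \<longleftrightarrow>
            (\<forall>y::real. exp_moment M a (first_passage \<xi> \<eta> y) < \<infinity>)) \<and>
           ((\<forall>y::real. exp_moment M a (first_passage \<xi> \<eta> y) < \<infinity>) \<longleftrightarrow>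
            exp_moment M a (ladder_epoch \<xi>) < \<infinity>) \<and>
           (exp_moment M a (ladder_epoch \<xi>) < \<infinity> \<longleftrightarrow>
            exp_rate M (\<xi> 0) \<ge> ereal a))"
proof -
  interpret perturbed_random_walk M \<xi> \<eta> by fact
  interpret ladder: perturbed_random_walk M \<xi> \<xi> by (rule perturbed_random_walk_self)
  note moment_iff = exp_moment_first_passage_finite_iff[OF \<open>a > 0\<close>]
  show ?thesis
  proof (intro conjI[of "_ \<longrightarrow> _"] impI)
    assume null: "\<P>(\<omega> in M. \<xi> 0 \<omega> < 0 \<and> \<eta> 0 \<omega> \<le> x) = 0"
    show "exp_moment M a (first_passage \<xi> \<eta> x) < \<infinity> \<longleftrightarrow>
            exp a * \<P>(\<omega> in M. \<xi> 0 \<omega> = 0 \<and> \<eta> 0 \<omega> \<le> x) < 1"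
      using green_finite_of_nonneg_steps[OF xi_measurable eta_measurable null, of a]
        green_infinite_of_zero_steps[OF xi_measurable eta_measurable, of a 0 0 x]
      unfolding moment_iff
      by (cases "exp a * \<P>(\<omega> in M. \<xi> 0 \<omega> = 0 \<and> \<eta> 0 \<omega> \<le> x) < 1") (auto simp: not_less)
  next
    assume p: "\<P>(\<omega> in M. \<xi> 0 \<omega> < 0 \<and> \<eta> 0 \<omega> \<le> x) > 0"
    \<comment> \<open>The four assertions are linked through \<open>?L\<close>: three are equivalent
      to it directly, while finiteness at all levels follows from it and implies finiteness at
      \<open>x\<close>.\<close>
    let ?L = "\<exists>t\<ge>0. (\<integral>\<^sup>+\<omega>. ennreal (exp (- t * \<xi> 0 \<omega>)) \<partial>M) \<le> ennreal (exp (- a))"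
    have "\<P>(\<omega> in M. \<xi> 0 \<omega> < 0 \<and> \<eta> 0 \<omega> \<le> x) \<le> \<P>(\<omega> in M. \<xi> 0 \<omega> < 0)"
      by (intro finite_measure_mono) auto
    with p have neg: "\<P>(\<omega> in M. \<xi> 0 \<omega> < 0) > 0" by linarith
    \<comment> \<open>For \<eta> = \<xi> at level 0 the descent event is just that of a negative
      step.\<close>
    have "{\<omega>\<in>space M. \<xi> 0 \<omega> < 0 \<and> \<xi> 0 \<omega> \<le> 0} = {\<omega>\<in>space M. \<xi> 0 \<omega> < 0}" by auto
    with neg have "exp_moment M a (ladder_epoch \<xi>) < \<infinity> \<longleftrightarrow> ?L"
      unfolding ladder_epoch_eq_first_passage
      using ladder.exp_moment_finite_iff_laplace[OF \<open>a > 0\<close>, of 0] by simp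
    moreover have "exp_moment M a (first_passage \<xi> \<eta> x) < \<infinity> \<longleftrightarrow> ?L"
      by (rule exp_moment_finite_iff_laplace[OF \<open>a > 0\<close> p])
    moreover have "\<forall>y. exp_moment M a (first_passage \<xi> \<eta> y) < \<infinity>" if ?L
      using that green_finite_of_laplace[OF xi_measurable eta_measurable \<open>a > 0\<close>]
      unfolding moment_iff by blast
    moreover have "exp_rate M (\<xi> 0) \<ge> ereal a \<longleftrightarrow> ?L"
      by (rule le_exp_rate_iff[OF xi_measurable neg])
    ultimately show "(exp_moment M a (first_passage \<xi> \<eta> x) < \<infinity> \<longleftrightarrow>
            (\<forall>y::real. exp_moment M a (first_passage \<xi> \<eta> y) < \<infinity>)) \<and>
           ((\<forall>y::real. exp_moment M a (first_passage \<xi> \<eta> y) < \<infinity>) \<longleftrightarrow>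
            exp_moment M a (ladder_epoch \<xi>) < \<infinity>) \<and>
           (exp_moment M a (ladder_epoch \<xi>) < \<infinity> \<longleftrightarrow>
            exp_rate M (\<xi> 0) \<ge> ereal a)"
      by blast
  qed
qed

end
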